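(* For every sufficiently large positive integer $k$ and every $c\ge 0.7\cdot 2^k$, there is a constant $\varepsilon>0$ such that the following holds. Let $\{F_n\}_{n\in\mathbb{N}}$ be a sequence of random $k$-CNFs, each $F_n$ drawn independently from $\mathcal{F}(k,n,cn)$. With probability $1$, there is a non-uniform decision tree reduction of block-depth $2$ from $\textsc{Refuter}(s(F_n\vdash_{\mathsf{Res}}\bot)<(1+\varepsilon)^n)$ to $\mathrm{rwPHP}(\mathsf{PLS})$ that is correct for all sufficiently large $n$.
   Context: $\mathcal{F}(k,n,m)$ is the distribution on $k$-CNFs over $n$ variables with $m$ clauses, each clause chosen independently and uniformly among all $\binom{n}{k}2^k$ ordinary width-$k$ clauses (no variable appears both positively and negatively). $\textsc{Refuter}(s(F\vdash_{\mathsf{Res}}\bot)<s)$: input is a purported resolution refutation of $F$ with fewer than $s$ nodes (each node: clause, tag resolution/weakening, earlier predecessor indices and resolved variable; valid iff the resolution rule $C\vee x,D\vee\overline x\vdash C\vee D$ or weakening $C\vdash C\vee D$ is correctly applied; last clause empty); a solution is an index of an invalid node; each node is a block. $\textsc{Iter}$: input $S:[L]\to[L]$; solutions $x$ with $x=0\wedge S(0)=0$, or $S(x)<x$, or $S(x)>x\wedge S(S(x))=S(x)$. $\mathrm{rwPHP}(\mathsf{PLS})$: input $f:[M]\to[N]$ with $M\le N/2$, for each $y\in[N]$ an $\textsc{Iter}$ instance $S_y:[L]\to[L]$ and $g_y:[L]\to[M]$; a solution is $(y,a)$ with $a$ a solution of $S_y$ and $f(g_y(a))\ne y$. *)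

theory Defs
  imports "HOL-Probability.Probability"
begin

text \<open>A literal is a pair (variable, sign): (x, True) is x, (x, False) is the negation of x.
  Variables of an n-variable formula are 0 ..< n.\<close>
type_synonym lit = "nat \<times> bool"
type_synonym clause = "lit set"
type_synonym cnf = "clause list"

text \<open>Ordinary width-k clauses over n variables: k literals on k distinct variables
  (so no variable occurs both positively and negatively). There are (n choose k) 2^k of them.\<close>
definition ordinary_clauses :: "nat \<Rightarrow> nat \<Rightarrow> clause set" where
  "ordinary_clauses k n = {C. card C = k \<and> (\<forall>l\<in>C. fst l < n) \<and> inj_on fst C}"

fun iid_list_pmf :: "'a pmf \<Rightarrow> nat \<Rightarrow> 'a list pmf" where
  "iid_list_pmf p 0 = return_pmf []"
| "iid_list_pmf p (Suc m) = bind_pmf p (\<lambda>C. map_pmf (\<lambda>F. C # F) (iid_list_pmf p m))"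

definition random_kcnf :: "nat \<Rightarrow> nat \<Rightarrow> nat \<Rightarrow> cnf pmf" where
  "random_kcnf k n m = iid_list_pmf (pmf_of_set (ordinary_clauses k n)) m"

datatype rtag = Axiom | ResStep | WeakStep

text \<open>A node: clause, tag, two predecessor indices, resolved variable.\<close>
type_synonym node = "clause \<times> rtag \<times> nat \<times> nat \<times> nat"

definition node_valid :: "cnf \<Rightarrow> nat \<Rightarrow> (nat \<Rightarrow> node) \<Rightarrow> nat \<Rightarrow> bool" where
  "node_valid F t P i =
     (case P i of (C, tg, j, l, x) \<Rightarrow>
        (i = t - 1 \<longrightarrow> C = {}) \<and>
        (case tg of
           Axiom \<Rightarrow> C \<in> set F
         | ResStep \<Rightarrow> j < i \<and> l < i \<and>
              (\<exists>A B. fst (P j) = A \<union> {(x, True)} \<and> fst (P l) = B \<union> {(x, False)} \<and> C = A \<union> B)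
         | WeakStep \<Rightarrow> j < i \<and> fst (P j) \<subseteq> C))"

definition refuter_sol :: "cnf \<Rightarrow> nat \<Rightarrow> (nat \<Rightarrow> node) \<Rightarrow> nat \<Rightarrow> bool" where
  "refuter_sol F t P i = (i < t \<and> \<not> node_valid F t P i)"

definition iter_sol :: "nat \<Rightarrow> (nat \<Rightarrow> nat) \<Rightarrow> nat \<Rightarrow> bool" where
  "iter_sol L S x = (x < L \<and> ((x = 0 \<and> S 0 = 0) \<or> S x < x \<or> (S x > x \<and> S (S x) = S x)))"

definition rwphp_pls_sol ::
  "nat \<Rightarrow> nat \<Rightarrow> (nat \<Rightarrow> nat) \<Rightarrow> (nat \<Rightarrow> nat \<Rightarrow> nat) \<Rightarrow> (nat \<Rightarrow> nat \<Rightarrow> nat) \<Rightarrow> nat \<Rightarrow> nat \<Rightarrow> bool" where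
  "rwphp_pls_sol N L f S g y a = (y < N \<and> iter_sol L (S y) a \<and> f (g y a) \<noteq> y)"

datatype ('a, 'b) dtree = Leaf 'b | Query nat "'a \<Rightarrow> ('a, 'b) dtree"

primrec dt_eval :: "('a, 'b) dtree \<Rightarrow> (nat \<Rightarrow> 'a) \<Rightarrow> 'b" where
  "dt_eval (Leaf b) x = b"
| "dt_eval (Query i k) x = dt_eval (k (x i)) x"

inductive dt_bounded :: "nat \<Rightarrow> nat \<Rightarrow> ('a, 'b) dtree \<Rightarrow> bool" where
  leaf: "dt_bounded t d (Leaf b)"
| query: "i < t \<Longrightarrow> (\<And>a. dt_bounded t d (k a)) \<Longrightarrow> dt_bounded t (Suc d) (Query i k)"

text \<open>A (non-uniform) decision tree reduction of block-depth d from Refuter on F with inputs of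
  t nodes (each node one block) to rwPHP(PLS): every input symbol of the target instance is
  computed by a decision tree, and every target solution is mapped by a decision tree to a
  solution of the source instance; correctness holds for every input.\<close>
definition refuter_to_rwphp_pls_reduction :: "cnf \<Rightarrow> nat \<Rightarrow> nat \<Rightarrow> bool" where
  "refuter_to_rwphp_pls_reduction F t d =
    (\<exists>(M::nat) (N::nat) (L::nat)
       (Tf :: nat \<Rightarrow> (node, nat) dtree) (TS :: nat \<Rightarrow> nat \<Rightarrow> (node, nat) dtree)
       (Tg :: nat \<Rightarrow> nat \<Rightarrow> (node, nat) dtree) (Tsol :: nat \<Rightarrow> nat \<Rightarrow> (node, nat) dtree).
       0 < N \<and> 0 < L \<and> real M \<le> real N / 2 \<and>
       (\<forall>x<M. dt_bounded t d (Tf x)) \<and>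
       (\<forall>y<N. \<forall>a<L. dt_bounded t d (TS y a) \<and> dt_bounded t d (Tg y a) \<and> dt_bounded t d (Tsol y a)) \<and>
       (\<forall>P :: nat \<Rightarrow> node.
          (\<forall>x<M. dt_eval (Tf x) P < N) \<and>
          (\<forall>y<N. \<forall>a<L. dt_eval (TS y a) P < L \<and> dt_eval (Tg y a) P < M) \<and>
          (\<forall>y<N. \<forall>a<L.
             rwphp_pls_sol N L (\<lambda>x. dt_eval (Tf x) P) (\<lambda>y' a'. dt_eval (TS y' a') P)
                (\<lambda>y' a'. dt_eval (Tg y' a') P) y a
             \<longrightarrow> refuter_sol F t P (dt_eval (Tsol y a) P))))"

end

theory Submission
  imports Defs
begin

text \<open>Expansion turns clauses of medium complexity into wide ones, and random restrictions kill wide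
  clauses. Fix an expanding \<open>F\<close>, and call a clause easy if, under a restriction, it is implied by few
  clauses of \<open>F\<close>. Walking down a purported refutation from the empty clause along hard clauses, one
  meets an unsound node or enters a clause of medium complexity. The latter contains linearly many
  variables of low degree, so all but an exponentially small fraction of the restrictions satisfy it,
  although no clause hard for a restriction is satisfied by it. Hence a restriction for which the walk
  ends in a medium clause is determined by the node and a short code. The restrictions take at most one
  variable out of each clause, which preserves expansion without any further randomness. Random
  \<open>k\<close>-CNFs expand almost surely from some \<open>n\<close> on, by a union bound and the Borel--Cantelli lemma.\<close>

section \<open>A walk through the refutation\<close>

lemma node_valid_iff:
  "node_valid F t P i \<longleftrightarrow>
     (i = t - 1 \<longrightarrow> fst (P i) = {}) \<and>
     (case P i of (C, tg, j, l, x) \<Rightarrow> (case tg of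
           Axiom \<Rightarrow> C \<in> set F
         | ResStep \<Rightarrow> j < i \<and> l < i \<and>
              (\<exists>A B. fst (P j) = A \<union> {(x, True)} \<and> fst (P l) = B \<union> {(x, False)} \<and> C = A \<union> B)
         | WeakStep \<Rightarrow> j < i \<and> fst (P j) \<subseteq> C))"
  by (cases "P i") (auto simp: node_valid_def)

text \<open>The step is computed from node \<open>i\<close> alone, so one query suffices.
  Predecessor indices that are not smaller make the walk stay, so that it never goes up, even on
  malformed nodes.\<close>

definition next_node :: "(clause \<Rightarrow> bool) \<Rightarrow> (clause \<Rightarrow> bool) \<Rightarrow> nat \<Rightarrow> node \<Rightarrow> nat" where
  "next_node hi md i nd = (case nd of (C, tg, j, l, x) \<Rightarrow>
     if \<not> hi C then i else
     (case tg of
        Axiom \<Rightarrow> i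
      | ResStep \<Rightarrow> if j < i \<and> l < i then (if md (C \<union> {(x, True)}) then j else l) else i
      | WeakStep \<Rightarrow> if j < i then j else i))"

text \<open>The largest clause that the next node can carry if the current node is sound. Exceeding
  it exposes the current node as unsound after reading just these two nodes.\<close>

definition next_bound :: "(clause \<Rightarrow> bool) \<Rightarrow> node \<Rightarrow> clause" where
  "next_bound md nd = (case nd of (C, tg, j, l, x) \<Rightarrow>
     (case tg of
        Axiom \<Rightarrow> C
      | ResStep \<Rightarrow> if md (C \<union> {(x, True)}) then C \<union> {(x, True)} else C \<union> {(x, False)}
      | WeakStep \<Rightarrow> C))"

lemma next_node_le: "next_node hi md i nd \<le> i"
  by (auto simp: next_node_def split: prod.splits rtag.splits)

text \<open>A sound node with a \<open>hi\<close> clause is not an axiom, hence has earlier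
  predecessors, and the walk would move to one of them.\<close>

lemma next_node_stuck:
  assumes "next_node hi md i (P i) = i" "node_valid F t P i" "\<And>C. C \<in> set F \<Longrightarrow> \<not> hi C"
  shows "\<not> hi (fst (P i))"
  using assms
  by (auto simp: next_node_def node_valid_iff split: prod.splits rtag.splits if_splits)

lemma next_node_moves:
  assumes "next_node hi md i (P i) \<noteq> i"
  shows "hi (fst (P i))"
    and "node_valid F t P i \<Longrightarrow> fst (P (next_node hi md i (P i))) \<subseteq> next_bound md (P i)"
  using assms
  by (auto simp: next_node_def next_bound_def node_valid_iff split: prod.splits rtag.splits if_splits)

lemma next_bound_medium:
  assumes "hi (fst nd)" "\<And>C. hi C \<Longrightarrow> md C"
    "\<And>C x. hi C \<Longrightarrow> md (C \<union> {(x, True)}) \<or> md (C \<union> {(x, False)})"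
  shows "md (next_bound md nd)"
  using assms by (cases nd) (auto simp: next_bound_def split: rtag.splits)

text \<open>The decoder has to be bounded on all inputs, not only on codes, because \<open>f\<close>
  must map into \<open>[N]\<close> whatever the purported refutation contains.\<close>

lemma finite_encoding:
  assumes "card (B :: nat set) \<le> q" "finite B" "\<And>y. y \<in> B \<Longrightarrow> y < N" "0 < N"
  shows "\<exists>e d. (\<forall>y\<in>B. e y < q \<and> d (e y) = y) \<and> (\<forall>z::nat. d z < N)"
proof -
  have "card B \<le> card {..<q}" using assms(1) by simp
  then obtain e where e: "e ` B \<subseteq> {..<q}" "inj_on e B"
    using card_le_inj[OF assms(2) finite_lessThan] by blast
  let ?d = "\<lambda>z. if z \<in> e ` B then inv_into B e z else 0"
  have 1: "e y < q \<and> ?d (e y) = y" if "y \<in> B" for y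
    using e(1) that inv_into_f_f[OF e(2) that] by (simp add: image_subset_iff)
  have 2: "?d z < N" for z
    using assms(3,4) inv_into_into[of z e B] by (cases "z \<in> e ` B") simp_all
  show ?thesis
    by (rule exI[of _ e], rule exI[of _ ?d], rule conjI, rule ballI, erule 1, rule allI, rule 2)
qed

text \<open>\<open>hi y\<close> marks the clauses that a walk down the purported refutation under the seed \<open>y\<close> keeps
  visiting and \<open>md y\<close> the possibly larger set it can step into. The walk leaves \<open>hi y\<close> at an
  unsound node, or at a clause for which \<open>y\<close> is one of at most \<open>q\<close> exceptional seeds; in the second
  case the node and the rank of \<open>y\<close> among these seeds compress \<open>y\<close>.\<close>

theorem reduction_from_random_walk:
  fixes hi md :: "'y \<Rightarrow> clause \<Rightarrow> bool"
  assumes fin: "finite Y" and t: "0 < t" and q: "0 < q" and card_Y: "2 * t * q \<le> card Y"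
    and hi_empty: "\<And>y. y \<in> Y \<Longrightarrow> hi y {}"
    and hi_axiom: "\<And>y C. y \<in> Y \<Longrightarrow> C \<in> set F \<Longrightarrow> \<not> hi y C"
    and hi_md: "\<And>y C. y \<in> Y \<Longrightarrow> hi y C \<Longrightarrow> md y C"
    and hi_res: "\<And>y C x. y \<in> Y \<Longrightarrow> hi y C \<Longrightarrow> md y (C \<union> {(x, True)}) \<or> md y (C \<union> {(x, False)})"
    and md_mono: "\<And>y C C'. y \<in> Y \<Longrightarrow> md y C \<Longrightarrow> C' \<subseteq> C \<Longrightarrow> md y C'"
    and few: "\<And>C. card {y \<in> Y. md y C \<and> \<not> hi y C} \<le> q"
  shows "refuter_to_rwphp_pls_reduction F t 2"
proof -
  define N where "N = card Y"
  have N: "0 < N" using card_Y t q unfolding N_def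
    by (metis mult_pos_pos order_less_le_trans zero_less_numeral)
  obtain s where s: "bij_betw s {0..<N} Y"
    using ex_bij_betw_nat_finite[OF fin] unfolding N_def by blast
  have sY: "s y \<in> Y" if "y < N" for y using s that by (auto simp: bij_betw_def)
  define B where "B C = {y. y < N \<and> md (s y) C \<and> \<not> hi (s y) C}" for C
  have card_B: "card (B C) \<le> q" for C
  proof -
    have "s ` B C \<subseteq> {y \<in> Y. md y C \<and> \<not> hi y C}" using sY by (auto simp: B_def)
    moreover have "inj_on s (B C)"
      using s by (auto simp: bij_betw_def B_def inj_on_def)
    ultimately have "card (B C) \<le> card {y \<in> Y. md y C \<and> \<not> hi y C}"
      using fin by (intro card_inj_on_le[of s]) auto
    then show ?thesis using few[of C] by simp
  qed
  have finB: "finite (B C)" for C by (auto simp: B_def)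
  \<comment> \<open>Encoder and decoder depend on the clause only, so \<open>f\<close>, which reads
    a single node, decodes with the partner of the encoder used by \<open>g\<close>.\<close>
  define E where "E C = (SOME e. \<exists>d. (\<forall>y\<in>B C. e y < q \<and> d (e y) = y) \<and> (\<forall>z::nat. d z < N))" for C
  define d where "d C = (SOME d. (\<forall>y\<in>B C. E C y < q \<and> d (E C y) = y) \<and> (\<forall>z::nat. d z < N))" for C
  have Ed: "(\<forall>y\<in>B C. E C y < q \<and> d C (E C y) = y) \<and> (\<forall>z::nat. d C z < N)" for C
  proof -
    have "\<exists>e d. (\<forall>y\<in>B C. e y < q \<and> d (e y) = y) \<and> (\<forall>z::nat. d z < N)"
      by (rule finite_encoding[OF card_B finB _ N]) (simp add: B_def)
    then have "\<exists>d. (\<forall>y\<in>B C. E C y < q \<and> d (E C y) = y) \<and> (\<forall>z::nat. d z < N)"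
      unfolding E_def by (rule someI_ex)
    then show ?thesis unfolding d_def by (rule someI_ex)
  qed
  have ed: "\<And>C y. y \<in> B C \<Longrightarrow> E C y < q \<and> d C (E C y) = y" and d: "\<And>C z. d C z < N"
    using Ed by auto
  define nx where "nx y = next_node (hi (s y)) (md (s y))" for y
  have nx_le: "nx y i nd \<le> i" for y i nd by (simp add: nx_def next_node_le)
  \<comment> \<open>An argument of \<open>f\<close> is a pair of a node, \<open>x div q\<close>, and
    a rank, \<open>x mod q\<close>; this gives \<open>t * q\<close> arguments.\<close>
  define Tf :: "nat \<Rightarrow> (node, nat) dtree"
    where "Tf x = Query (x div q) (\<lambda>nd. Leaf (d (fst nd) (x mod q)))" for x
  \<comment> \<open>Position \<open>a\<close> stands for node \<open>t - 1 - a\<close>. The reversal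
    turns the descending walk from the last node into a nondecreasing map starting at position
    0.\<close>
  define TS :: "nat \<Rightarrow> nat \<Rightarrow> (node, nat) dtree"
    where "TS y a = Query (t - 1 - a) (\<lambda>nd. Leaf (t - 1 - nx y (t - 1 - a) nd))" for y a
  \<comment> \<open>The code refers to the clause at the node after the step, which costs the second
    query. The value 0 for seeds that are not exceptional only has to be in range.\<close>
  define Tg :: "nat \<Rightarrow> nat \<Rightarrow> (node, nat) dtree"
    where "Tg y a = Query (t - 1 - a) (\<lambda>nd. Query (nx y (t - 1 - a) nd) (\<lambda>nd'.
      Leaf (if y \<in> B (fst nd') then nx y (t - 1 - a) nd * q + E (fst nd') y else 0)))" for y a
  \<comment> \<open>The next node is blamed if its clause respects the bound, the current node
    otherwise. If the walk stays, both answers coincide.\<close>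
  define Tsol :: "nat \<Rightarrow> nat \<Rightarrow> (node, nat) dtree"
    where "Tsol y a = Query (t - 1 - a) (\<lambda>nd. Query (nx y (t - 1 - a) nd) (\<lambda>nd'.
      Leaf (if fst nd' \<subseteq> next_bound (md (s y)) nd then nx y (t - 1 - a) nd else t - 1 - a)))" for y a
  have nx_t: "nx y (t - 1 - a) nd < t" for y a nd
    using nx_le[of y "t - 1 - a" nd] t by linarith
  have two: "2 = Suc (Suc 0)" by simp
  have b_f: "dt_bounded t 2 (Tf x)" if "x < t * q" for x
    unfolding Tf_def two using that by (intro dt_bounded.intros) (simp add: less_mult_imp_div_less)
  have b_S: "dt_bounded t 2 (TS y a)" for y a
    unfolding TS_def two using t by (intro dt_bounded.intros) linarith
  have b_g: "dt_bounded t 2 (Tg y a)" for y a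
    unfolding Tg_def two by (intro dt_bounded.intros) (use t nx_t in auto)
  have b_sol: "dt_bounded t 2 (Tsol y a)" for y a
    unfolding Tsol_def two by (intro dt_bounded.intros) (use t nx_t in auto)
  have g_lt: "dt_eval (Tg y a) P < t * q" for y a P
  proof -
    have "i * q + z < t * q" if "i < t" "z < q" for i z
    proof -
      have "i * q + z < Suc i * q" using that by simp
      also have "\<dots> \<le> t * q" using that by (intro mult_right_mono) auto
      finally show ?thesis .
    qed
    then show ?thesis using nx_t ed t q by (auto simp: Tg_def)
  qed
  have sol: "refuter_sol F t P (dt_eval (Tsol y a) P)"
    if y: "y < N" and a: "a < t"
      and *: "rwphp_pls_sol N t (\<lambda>x. dt_eval (Tf x) P) (\<lambda>y' a'. dt_eval (TS y' a') P)
                (\<lambda>y' a'. dt_eval (Tg y' a') P) y a" for P y a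
  proof -
    define i where "i = t - 1 - a"
    define i' where "i' = nx y i (P i)"
    define i'' where "i'' = nx y i' (P i')"
    have ii: "i' \<le> i" "i'' \<le> i'" "i < t" "a = t - 1 - i"
      using nx_le a t by (auto simp: i_def i'_def i''_def)
    have S_a: "dt_eval (TS y a) P = t - 1 - i'" by (simp add: TS_def i'_def i_def)
    have "t - 1 - (t - 1 - i') = i'" using ii by simp
    then have S_S_a: "dt_eval (TS y (t - 1 - i')) P = t - 1 - i''" by (simp add: TS_def i''_def)
    have iter: "iter_sol t (\<lambda>a'. dt_eval (TS y a') P) a"
      and fg: "dt_eval (Tf (dt_eval (Tg y a) P)) P \<noteq> y"
      using * by (auto simp: rwphp_pls_sol_def)
    have out: "dt_eval (Tsol y a) P = (if fst (P i') \<subseteq> next_bound (md (s y)) (P i) then i' else i)"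
      by (simp add: Tsol_def i_def i'_def)
    note facts = hi_empty[OF sY[OF y]] hi_axiom[OF sY[OF y]]
    show ?thesis
    proof (cases "i' = i")
      case True
      \<comment> \<open>A fixed point of the successor map is an Iter solution only at position 0,
        so the walk is stuck at its start.\<close>
      then have "a = 0" using iter S_a S_S_a ii by (auto simp: iter_sol_def i''_def i'_def)
      then have "i = t - 1" by (simp add: i_def)
      have "\<not> node_valid F t P i"
      proof
        assume v: "node_valid F t P i"
        then have "fst (P i) = {}" using \<open>i = t - 1\<close> by (simp add: node_valid_iff)
        moreover have "\<not> hi (s y) (fst (P i))"
          using next_node_stuck[OF _ v, of "hi (s y)" "md (s y)"] True facts
          by (simp add: i'_def nx_def)
        ultimately show False using facts by simp
      qed
      then show ?thesis using True ii out by (simp add: refuter_sol_def)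
    next
      case False
      then have "i' < i" using ii by simp
      \<comment> \<open>The position increases here, so the solution is of the third kind: the walk
        enters \<open>i'\<close> and stays there.\<close>
      then have "dt_eval (TS y (t - 1 - i')) P = t - 1 - i'"
        using iter S_a ii by (auto simp: iter_sol_def)
      then have stuck: "i'' = i'" using S_S_a ii by simp
      have hi: "hi (s y) (fst (P i))"
        using next_node_moves(1)[of "hi (s y)" "md (s y)" i P] False by (simp add: i'_def nx_def)
      show ?thesis
      proof (cases "fst (P i') \<subseteq> next_bound (md (s y)) (P i)")
        case sub: False
        then have "\<not> node_valid F t P i"
          using next_node_moves(2)[of "hi (s y)" "md (s y)" i P F t] False by (auto simp: i'_def nx_def)
        then show ?thesis using sub ii out by (simp add: refuter_sol_def)
      next
        case sub: True
        have "md (s y) (next_bound (md (s y)) (P i))"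
          by (rule next_bound_medium[of "hi (s y)"]) (use hi hi_md hi_res sY[OF y] in auto)
        then have md': "md (s y) (fst (P i'))" using md_mono[OF sY[OF y]] sub by blast
        \<comment> \<open>Otherwise \<open>y\<close> is exceptional for this clause,
          \<open>g\<close> returns its code and \<open>f\<close> decodes it, contrary to
          \<open>fg\<close>.\<close>
        have hi': "hi (s y) (fst (P i'))"
        proof (rule ccontr)
          assume "\<not> hi (s y) (fst (P i'))"
          then have yB: "y \<in> B (fst (P i'))" using md' y by (simp add: B_def)
          then have "dt_eval (Tg y a) P = i' * q + E (fst (P i')) y"
            unfolding i_def i'_def by (simp add: Tg_def)
          then have "dt_eval (Tf (dt_eval (Tg y a) P)) P = y"
            using ed[OF yB] by (simp add: Tf_def)
          then show False using fg by simp
        qed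
        have "\<not> node_valid F t P i'"
          using next_node_stuck[of "hi (s y)" "md (s y)" i' P F t] stuck hi' facts
          by (auto simp: i''_def nx_def)
        then show ?thesis using sub ii out by (simp add: refuter_sol_def)
      qed
    qed
  qed
  have S_lt: "dt_eval (TS y a) P < t" for y a P using t by (simp add: TS_def) 
  have f_lt: "dt_eval (Tf x) P < N" for x P using d by (simp add: Tf_def)
  have "real (2 * t * q) \<le> real N" using card_Y by (simp add: N_def del: of_nat_mult)
  then have MN: "real (t * q) \<le> real N / 2" by simp
  show ?thesis
    unfolding refuter_to_rwphp_pls_reduction_def
    by (rule exI[of _ "t * q"], rule exI[of _ N], rule exI[of _ t], rule exI[of _ Tf],
        rule exI[of _ TS], rule exI[of _ Tg], rule exI[of _ Tsol])
      (intro conjI allI impI; simp only: N t MN b_f b_S b_g b_sol f_lt S_lt g_lt sol)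
qed

section \<open>Random restrictions of expanding formulas\<close>

text \<open>Greedy choice: pick \<open>v\<close>, discard the at most \<open>d\<close> members whose
  sets meet \<open>N v\<close>, and repeat. As \<open>N v\<close> is nonempty, \<open>v\<close> is
  among those discarded.\<close>

lemma disjoint_packing:
  fixes N :: "'a \<Rightarrow> 'b set"
  assumes "finite W" "\<And>v. v \<in> W \<Longrightarrow> card {u \<in> W. N u \<inter> N v \<noteq> {}} \<le> d"
    "\<And>v. v \<in> W \<Longrightarrow> N v \<noteq> {}"
  shows "\<exists>W'\<subseteq>W. disjoint_family_on N W' \<and> card W \<le> d * card W'"
  using assms
proof (induction W rule: finite_psubset_induct)
  case (psubset W)
  show ?case
  proof (cases "W = {}")
    case True
    then show ?thesis by (intro exI[of _ "{}"]) (auto simp: disjoint_family_on_def)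
  next
    case False
    then obtain v where v: "v \<in> W" by blast
    define W1 where "W1 = {u \<in> W. N u \<inter> N v = {}}"
    have "v \<notin> W1" using psubset.prems(2)[OF v] by (simp add: W1_def)
    then have sub: "W1 \<subset> W" using v by (auto simp: W1_def)
    have "card {u \<in> W1. N u \<inter> N z \<noteq> {}} \<le> d" if "z \<in> W1" for z
    proof -
      have "card {u \<in> W1. N u \<inter> N z \<noteq> {}} \<le> card {u \<in> W. N u \<inter> N z \<noteq> {}}"
        using psubset.hyps by (intro card_mono) (auto simp: W1_def)
      also have "\<dots> \<le> d" using psubset.prems(1)[of z] that by (simp add: W1_def)
      finally show ?thesis .
    qed
    moreover have "N z \<noteq> {}" if "z \<in> W1" for z using psubset.prems(2)[of z] that by (simp add: W1_def)
    ultimately obtain W2 where W2: "W2 \<subseteq> W1" "disjoint_family_on N W2" "card W1 \<le> d * card W2"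
      using psubset.IH[OF sub] by blast
    have "disjoint_family_on N (insert v W2)"
      using W2(1,2) unfolding disjoint_family_on_def W1_def by blast
    moreover have "card W \<le> d * card (insert v W2)"
    proof -
      have "W = W1 \<union> {u \<in> W. N u \<inter> N v \<noteq> {}}" by (auto simp: W1_def)
      then have "card W \<le> card W1 + card {u \<in> W. N u \<inter> N v \<noteq> {}}"
        by (metis card_Un_le)
      also have "\<dots> \<le> d * card W2 + d" using W2(3) psubset.prems(1)[OF v] by simp
      also have "\<dots> = d * card (insert v W2)"
        using W2(1) \<open>v \<notin> W1\<close> finite_subset[OF W2(1)] finite_subset[of W1 W] sub psubset.hyps
        by (subst card_insert_disjoint) auto
      finally show ?thesis .
    qed
    moreover have "insert v W2 \<subseteq> W" using W2(1) v sub by blast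
    ultimately show ?thesis by blast
  qed
qed

text \<open>For uniform \<open>y\<close>, the values on disjoint sets are independent, and each
  pattern is avoided with probability at most \<open>1 - 1 / CARD('c) ^ d\<close>. The induction
  varies \<open>V\<close> because it splits off the coordinates in \<open>N v\<close>.\<close>

lemma card_avoid_patterns:
  fixes p :: "'a \<Rightarrow> 'b \<Rightarrow> 'c::finite" and N :: "'a \<Rightarrow> 'b set"
  assumes "finite W" "finite V" "\<And>v. v \<in> W \<Longrightarrow> N v \<subseteq> V \<and> card (N v) \<le> d" "disjoint_family_on N W"
  shows "real (card {y \<in> V \<rightarrow>\<^sub>E UNIV. \<forall>v\<in>W. \<exists>u\<in>N v. y u \<noteq> p v u})
    \<le> real CARD('c) ^ card V * (1 - 1 / real CARD('c) ^ d) ^ card W"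
  using assms
proof (induction W arbitrary: V rule: finite_induct)
  case empty
  then show ?case by (simp add: card_PiE)
next
  case (insert v W)
  define q where "q = real CARD('c)"
  have q: "q \<ge> 1" unfolding q_def by (simp add: Suc_leI)
  have v: "N v \<subseteq> V" "card (N v) \<le> d" using insert.prems by auto
  have finN: "finite (N v)" using v insert.prems finite_subset by blast
  define A where "A = {y \<in> V \<rightarrow>\<^sub>E (UNIV :: 'c set). \<forall>v\<in>insert v W. \<exists>u\<in>N v. y u \<noteq> p v u}"
  define A1 where "A1 = {y \<in> (V - N v) \<rightarrow>\<^sub>E (UNIV :: 'c set). \<forall>v\<in>W. \<exists>u\<in>N v. y u \<noteq> p v u}"
  define A2 where "A2 = (N v \<rightarrow>\<^sub>E (UNIV :: 'c set)) - {restrict (p v) (N v)}"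
  have disj: "N w \<inter> N v = {}" if "w \<in> W" for w
    using insert.prems(3) insert.hyps that by (auto simp: disjoint_family_on_def)
  have "real (card A1) \<le> q ^ card (V - N v) * (1 - 1 / q ^ d) ^ card W"
    unfolding A1_def q_def
  proof (rule insert.IH)
    show "N w \<subseteq> V - N v \<and> card (N w) \<le> d" if "w \<in> W" for w
      using insert.prems(2)[of w] disj[OF that] that by blast
    show "disjoint_family_on N W"
      using insert.prems(3) by (auto simp: disjoint_family_on_def)
  qed (use insert.prems in auto)
  moreover have "real (card A2) \<le> q ^ card (N v) * (1 - 1 / q ^ d)"
  proof -
    have "card A2 = CARD('c) ^ card (N v) - 1"
      unfolding A2_def using finN by (subst card_Diff_singleton) (auto simp: card_PiE)
    then have "real (card A2) = q ^ card (N v) - 1"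
      by (simp add: q_def of_nat_diff Suc_leI)
    moreover have "q ^ card (N v) \<le> q ^ d" using q v by (intro power_increasing) auto
    then have "q ^ card (N v) * (1 / q ^ d) \<le> 1" using q by (simp add: divide_simps)
    ultimately show ?thesis by (simp add: right_diff_distrib)
  qed
  moreover have "card A \<le> card (A2 \<times> A1)"
  proof (rule card_inj_on_le[where f = "\<lambda>y. (restrict y (N v), restrict y (V - N v))"])
    have "y = z" if "y \<in> V \<rightarrow>\<^sub>E UNIV" "z \<in> V \<rightarrow>\<^sub>E UNIV"
      "restrict y (N v) = restrict z (N v)" "restrict y (V - N v) = restrict z (V - N v)"
      for y z :: "'b \<Rightarrow> 'c"
    proof
      fix u
      show "y u = z u"
      proof (cases "u \<in> V")
        case True
        then show ?thesis using fun_cong[OF that(3), of u] fun_cong[OF that(4), of u]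
          by (cases "u \<in> N v") auto
      next
        case False
        then show ?thesis using that(1,2) by (auto simp: PiE_def extensional_def)
      qed
    qed
    then show "inj_on (\<lambda>y. (restrict y (N v), restrict y (V - N v))) A"
      unfolding A_def by (intro inj_onI) auto
    have "restrict y (N v) \<in> A2" if "y \<in> A" for y
    proof -
      obtain u where "u \<in> N v" "y u \<noteq> p v u" using \<open>y \<in> A\<close> by (auto simp: A_def)
      then have "restrict y (N v) \<noteq> restrict (p v) (N v)" by (metis restrict_apply')
      then show ?thesis by (simp add: A2_def)
    qed
    moreover have "restrict y (V - N v) \<in> A1" if "y \<in> A" for y
    proof -
      have "\<exists>u\<in>N w. restrict y (V - N v) u \<noteq> p w u" if "w \<in> W" for w
      proof -
        obtain u where u: "u \<in> N w" "y u \<noteq> p w u" using \<open>y \<in> A\<close> \<open>w \<in> W\<close> by (auto simp: A_def)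
        have "u \<in> V - N v" using u(1) disj[OF that] insert.prems(2)[of w] that by blast
        then show ?thesis using u by (intro bexI[of _ u]) auto
      qed
      then show ?thesis by (simp add: A1_def)
    qed
    ultimately show "(\<lambda>y. (restrict y (N v), restrict y (V - N v))) ` A \<subseteq> A2 \<times> A1" by auto
    have "finite (N v \<rightarrow>\<^sub>E (UNIV :: 'c set))" "finite ((V - N v) \<rightarrow>\<^sub>E (UNIV :: 'c set))"
      using finN insert.prems by (auto intro!: finite_PiE)
    then show "finite (A2 \<times> A1)"
      unfolding A2_def A1_def by (intro finite_cartesian_product) auto
  qed
  ultimately have "real (card A) \<le> (q ^ card (N v) * (1 - 1 / q ^ d)) * (q ^ card (V - N v) * (1 - 1 / q ^ d) ^ card W)"
  proof -
    assume 1: "real (card A1) \<le> q ^ card (V - N v) * (1 - 1 / q ^ d) ^ card W"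
      and 2: "real (card A2) \<le> q ^ card (N v) * (1 - 1 / q ^ d)" and 3: "card A \<le> card (A2 \<times> A1)"
    have "real (card A) \<le> real (card A2) * real (card A1)"
      using 3 by (metis card_cartesian_product of_nat_le_iff of_nat_mult)
    also have "\<dots> \<le> (q ^ card (N v) * (1 - 1 / q ^ d)) * (q ^ card (V - N v) * (1 - 1 / q ^ d) ^ card W)"
      using 1 2 q by (intro mult_mono) auto
    finally show ?thesis .
  qed
  also have "\<dots> = q ^ (card (N v) + card (V - N v)) * (1 - 1 / q ^ d) ^ Suc (card W)"
    by (simp add: power_add)
  also have "card (N v) + card (V - N v) = card V"
    using v finN insert.prems(1) by (simp add: card_Diff_subset card_mono)
  also have "Suc (card W) = card (insert v W)" using insert.hyps by simp
  finally show ?case unfolding A_def q_def .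
qed

section \<open>Variables occurring in exactly one clause\<close>

lemma sum_occurrences_le:
  fixes G :: "clause set"
  assumes "finite V" "finite G" "\<And>D. D \<in> G \<Longrightarrow> finite D \<and> card (fst ` D) \<le> k"
  shows "(\<Sum>v\<in>V. card {D \<in> G. v \<in> fst ` D}) \<le> k * card G"
proof -
  have "(\<Sum>v\<in>V. card {D \<in> G. v \<in> fst ` D}) = (\<Sum>D\<in>G. card {v \<in> V. v \<in> fst ` D})"
    using assms by (intro sum_multicount_gen) auto
  also have "\<dots> \<le> (\<Sum>D\<in>G. k)"
  proof (rule sum_mono)
    fix D assume D: "D \<in> G"
    have "card {v \<in> V. v \<in> fst ` D} \<le> card (fst ` D)"
      using assms(3)[OF D] by (intro card_mono) auto
    then show "card {v \<in> V. v \<in> fst ` D} \<le> k" using assms(3)[OF D] by simp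
  qed
  finally show ?thesis by (simp add: mult.commute)
qed

text \<open>Double counting of incidences: a unique variable contributes one, every other variable
  at least two.\<close>

lemma card_unique_variables:
  fixes G :: "clause set"
  assumes "finite G" "\<And>D. D \<in> G \<Longrightarrow> finite D \<and> card (fst ` D) \<le> k"
  shows "2 * card (fst ` \<Union>G) \<le> k * card G + card {v \<in> fst ` \<Union>G. card {D \<in> G. v \<in> fst ` D} = 1}"
proof -
  let ?V = "fst ` \<Union>G" and ?o = "\<lambda>v. card {D \<in> G. v \<in> fst ` D}"
  have fin: "finite ?V" using assms by auto
  have "2 \<le> ?o v + (if ?o v = 1 then 1 else 0)" if v: "v \<in> ?V" for v
  proof -
    have "{D \<in> G. v \<in> fst ` D} \<noteq> {}" using v by auto
    then have "?o v > 0" using assms(1) by (simp add: card_gt_0_iff)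
    then show ?thesis by auto
  qed
  then have "(\<Sum>v\<in>?V. 2) \<le> (\<Sum>v\<in>?V. ?o v + (if ?o v = 1 then 1 else 0))" by (intro sum_mono) auto
  then have "2 * card ?V \<le> (\<Sum>v\<in>?V. ?o v) + (\<Sum>v\<in>?V. if ?o v = 1 then 1 else 0)"
    by (simp add: sum.distrib)
  also have "(\<Sum>v\<in>?V. if ?o v = 1 then 1 else 0) = card {v \<in> ?V. ?o v = 1}"
    using fin by (simp add: sum.If_cases Int_def)
  also have "(\<Sum>v\<in>?V. ?o v) \<le> k * card G" by (rule sum_occurrences_le[OF fin assms])
  finally show ?thesis by simp
qed

section \<open>Restricted expanders: easy, medium and hard clauses\<close>

definition sat :: "(nat \<Rightarrow> bool) \<Rightarrow> clause \<Rightarrow> bool" where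
  "sat \<alpha> C \<longleftrightarrow> (\<exists>l\<in>C. \<alpha> (fst l) = snd l)"

locale expander_cnf =
  fixes F :: cnf and n k r s b :: nat
  assumes clauses: "D \<in> set F \<Longrightarrow> finite D \<and> card (fst ` D) \<le> k \<and> fst ` D \<subseteq> {..<n}"
    and expansion: "G \<subseteq> set F \<Longrightarrow> G \<noteq> {} \<Longrightarrow> card G \<le> s \<Longrightarrow> r * card G \<le> card (fst ` \<Union>G)"
    and k_r: "k + 2 \<le> 2 * r" and s: "1 \<le> s"
begin

definition low :: "nat set" where
  "low = {v \<in> {..<n}. card {D \<in> set F. v \<in> fst ` D} \<le> b}"

text \<open>Only variables in \<open>low\<close> can get fixed, so only they compete with
  \<open>v\<close>. Excluding the others also keeps the conflict graph of bounded degree.\<close>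

definition nbh :: "nat \<Rightarrow> nat set" where
  "nbh v = insert v {u \<in> low. \<exists>D\<in>set F. v \<in> fst ` D \<and> u \<in> fst ` D}"

text \<open>A seed \<open>y\<close> proposes to fix the variables \<open>v\<close> with \<open>y v \<noteq> None\<close>; a proposal is carried out
  only if no variable sharing a clause with \<open>v\<close> is proposed. So every clause of \<open>F\<close> loses at most
  one variable, and the events that variables with disjoint neighbourhoods get fixed to given values
  are independent.\<close>

definition fixed :: "(nat \<Rightarrow> bool option) \<Rightarrow> nat set" where
  "fixed y = {v \<in> low. y v \<noteq> None \<and> (\<forall>u\<in>nbh v - {v}. y u = None)}"

definition implied :: "(nat \<Rightarrow> bool option) \<Rightarrow> clause set \<Rightarrow> clause \<Rightarrow> bool" where
  "implied y G C \<longleftrightarrow>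
     (\<forall>\<alpha>. (\<forall>v\<in>fixed y. y v = Some (\<alpha> v)) \<longrightarrow> (\<forall>D\<in>G. sat \<alpha> D) \<longrightarrow> sat \<alpha> C)"

text \<open>This bounds the usual semantic complexity of a clause, the least number of axioms
  implying it, relativised to the restriction.\<close>

definition easy :: "nat \<Rightarrow> (nat \<Rightarrow> bool option) \<Rightarrow> clause \<Rightarrow> bool" where
  "easy m y C \<longleftrightarrow> (\<exists>G\<subseteq>set F. card G \<le> m \<and> implied y G C)"

lemma fixed_unique:
  assumes "D \<in> set F" "u \<in> fixed y" "v \<in> fixed y" "u \<in> fst ` D" "v \<in> fst ` D"
  shows "u = v"
proof (rule ccontr)
  assume "u \<noteq> v"
  then have "u \<in> nbh v - {v}" using assms by (auto simp: nbh_def fixed_def)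
  then show False using assms(2,3) by (auto simp: fixed_def)
qed

text \<open>Expansion with \<open>k + 2 \<le> 2 * r\<close> yields at least
  \<open>2 * card G\<close> variables unique to one clause of \<open>G\<close>; at most one per
  clause is fixed, so \<open>card G\<close> of them stay free. Each of these occurs in
  \<open>C\<close> by minimality. The cut to \<open>{..<n}\<close> gives a finite set even though
  clauses of a purported refutation may be infinite.\<close>

lemma minimal_implied_wide:
  assumes G: "G \<subseteq> set F" "card G \<le> s" "implied y G C"
    and minimal: "\<And>D. D \<in> G \<Longrightarrow> \<not> implied y (G - {D}) C"
  shows "\<exists>X\<subseteq>fst ` C \<inter> {..<n}. card G \<le> card X"
proof (cases "G = {}")
  case True
  then show ?thesis by auto
next
  case False
  define U where "U = {v \<in> fst ` \<Union>G. card {D \<in> G. v \<in> fst ` D} = 1}"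
  have finG: "finite G" using G(1) finite_subset by blast
  have cl: "finite D \<and> card (fst ` D) \<le> k" if "D \<in> G" for D using clauses[of D] that G(1) by blast
  have "2 * (r * card G) \<le> k * card G + card U"
    using card_unique_variables[OF finG cl] expansion[OF G(1) False G(2)] unfolding U_def by linarith
  moreover have "(k + 2) * card G \<le> 2 * r * card G" using k_r by (intro mult_right_mono) auto
  ultimately have "2 * card G \<le> card U" by (simp add: algebra_simps)
  moreover have "card (U \<inter> fixed y) \<le> card G"
  proof -
    have "U \<inter> fixed y \<subseteq> (\<Union>D\<in>G. fst ` D \<inter> fixed y)" by (auto simp: U_def)
    then have "card (U \<inter> fixed y) \<le> card (\<Union>D\<in>G. fst ` D \<inter> fixed y)"
      using finG cl by (intro card_mono) auto
    also have "\<dots> \<le> (\<Sum>D\<in>G. card (fst ` D \<inter> fixed y))" by (rule card_UN_le[OF finG])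
    also have "\<dots> \<le> (\<Sum>D\<in>G. 1)"
    proof (rule sum_mono)
      fix D assume "D \<in> G"
      then have "D \<in> set F" using G(1) by blast
      then have "\<forall>u\<in>fst ` D \<inter> fixed y. \<forall>v\<in>fst ` D \<inter> fixed y. u = v"
        using fixed_unique by blast
      then show "card (fst ` D \<inter> fixed y) \<le> 1"
        using cl[OF \<open>D \<in> G\<close>] by (subst One_nat_def, subst card_le_Suc0_iff_eq) auto
    qed
    finally show ?thesis by simp
  qed
  moreover have "finite U" using finG cl by (auto simp: U_def)
  then have "card U = card (U \<inter> fixed y) + card (U - fixed y)"
    by (metis card_Int_Diff)
  ultimately have "card G \<le> card (U - fixed y)" by linarith
  moreover have "U - fixed y \<subseteq> fst ` C \<inter> {..<n}"
  proof
    fix v assume v: "v \<in> U - fixed y"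
    then obtain D where D: "{D \<in> G. v \<in> fst ` D} = {D}" by (auto simp: U_def card_1_singleton_iff)
    then have DG: "D \<in> G" "v \<in> fst ` D" by blast+
    then obtain c where c: "(v, c) \<in> D" by auto
    obtain \<alpha> where \<alpha>: "\<forall>v\<in>fixed y. y v = Some (\<alpha> v)" "\<forall>E\<in>G - {D}. sat \<alpha> E" "\<not> sat \<alpha> C"
      using minimal[OF DG(1)] by (auto simp: implied_def)
    have "v \<in> fst ` C"
    proof (rule ccontr)
      assume nv: "v \<notin> fst ` C"
      \<comment> \<open>Flipping \<open>v\<close> repairs \<open>D\<close> and affects neither the
        other clauses of \<open>G\<close>, nor \<open>C\<close>, nor the fixed variables, so \<beta>
        contradicts the implication.\<close>
      let ?\<beta> = "\<alpha>(v := c)"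
      have same: "sat ?\<beta> E = sat \<alpha> E" if "v \<notin> fst ` E" for E
        using that by (auto simp: sat_def image_iff)
      have "sat ?\<beta> E" if "E \<in> G" for E
      proof (cases "E = D")
        case True
        then show ?thesis using c by (auto simp: sat_def intro!: bexI[of _ "(v, c)"])
      next
        case False
        then have "v \<notin> fst ` E" using D that by blast
        then show ?thesis using same \<alpha>(2) that False by blast
      qed
      moreover have "\<forall>v\<in>fixed y. y v = Some (?\<beta> v)" using \<alpha>(1) v by auto
      ultimately have "sat ?\<beta> C" using G(3) unfolding implied_def by (elim allE[of _ ?\<beta>]) simp
      then show False using same[OF nv] \<alpha>(3) by simp
    qed
    moreover have "v < n" using DG G(1) clauses[of D] by blast
    ultimately show "v \<in> fst ` C \<inter> {..<n}" by simp
  qed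
  ultimately show ?thesis by blast
qed

lemma easy_minimal:
  assumes "easy m y C"
  obtains G where "G \<subseteq> set F" "card G \<le> m" "implied y G C" "\<And>D. D \<in> G \<Longrightarrow> \<not> implied y (G - {D}) C"
proof -
  let ?P = "\<lambda>G. G \<subseteq> set F \<and> card G \<le> m \<and> implied y G C"
  obtain G0 where "?P G0" using assms unfolding easy_def by auto
  then have "\<exists>G. ?P G \<and> (\<forall>H. ?P H \<longrightarrow> card G \<le> card H)" by (rule ex_has_least_nat)
  then obtain G where G: "?P G" "\<And>H. ?P H \<Longrightarrow> card G \<le> card H" by metis
  have "\<not> implied y (G - {D}) C" if "D \<in> G" for D
  proof
    assume "implied y (G - {D}) C"
    moreover have lt: "card (G - {D}) < card G"
      using G(1) that finite_subset[of G "set F"] by (intro card_Diff1_less) auto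
    ultimately have "?P (G - {D})" using G(1) by auto
    then show False using G(2)[of "G - {D}"] lt by linarith
  qed
  with G(1) show ?thesis by (intro that[of G]) simp_all
qed

lemma easy_weaken: "easy m y C' \<Longrightarrow> C' \<subseteq> C \<Longrightarrow> easy m y C"
proof -
  assume "easy m y C'" and sub: "C' \<subseteq> C"
  then obtain G where G: "G \<subseteq> set F" "card G \<le> m" "implied y G C'" unfolding easy_def by auto
  moreover have "sat \<alpha> C" if "sat \<alpha> C'" for \<alpha> using that sub by (auto simp: sat_def)
  then have "implied y G C" using G(3) by (simp add: implied_def)
  ultimately show "easy m y C" unfolding easy_def by auto
qed

lemma easy_mono: "easy m y C \<Longrightarrow> m \<le> m' \<Longrightarrow> easy m' y C"
  unfolding easy_def by (elim exE, intro exI conjI) (erule conjunct1, auto)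

lemma easy_axiom: "C \<in> set F \<Longrightarrow> easy s y C"
  unfolding easy_def by (rule exI[of _ "{C}"]) (use s in \<open>auto simp: implied_def\<close>)

text \<open>The measure is subadditive under resolution. This is why the walk cannot jump from hard
  clauses past the range between \<open>s div 2\<close> and \<open>s\<close>.\<close>

lemma easy_resolution:
  assumes "easy m y (C \<union> {(x, True)})" "easy m y (C \<union> {(x, False)})"
  shows "easy (2 * m) y C"
proof -
  obtain G H where G: "G \<subseteq> set F" "card G \<le> m" "implied y G (C \<union> {(x, True)})"
    and H: "H \<subseteq> set F" "card H \<le> m" "implied y H (C \<union> {(x, False)})"
    using assms unfolding easy_def by auto
  have "card (G \<union> H) \<le> 2 * m" using card_Un_le[of G H] G(2) H(2) by linarith
  moreover have "implied y (G \<union> H) C"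
    unfolding implied_def
  proof (intro allI impI)
    fix \<alpha> assume "\<forall>v\<in>fixed y. y v = Some (\<alpha> v)" "\<forall>D\<in>G \<union> H. sat \<alpha> D"
    then have "sat \<alpha> (C \<union> {(x, True)})" "sat \<alpha> (C \<union> {(x, False)})"
      using G(3) H(3) by (auto simp: implied_def)
    then show "sat \<alpha> C" by (auto simp: sat_def)
  qed
  ultimately show ?thesis using G(1) H(1) unfolding easy_def by (intro exI[of _ "G \<union> H"]) auto
qed

text \<open>The width bound forces a minimal implying set to be empty, but the restriction is
  consistent and the empty clause is false.\<close>

lemma not_easy_empty: "\<not> easy s y {}"
proof
  assume "easy s y {}"
  then obtain G where G: "G \<subseteq> set F" "card G \<le> s" "implied y G {}"
    "\<forall>D\<in>G. \<not> implied y (G - {D}) {}" using easy_minimal by metis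
  have "card G = 0" using minimal_implied_wide[OF G(1-3)] G(4) by auto
  then have "G = {}" using G(1) finite_subset by fastforce
  have "\<forall>v\<in>fixed y. y v = Some (the (y v))" by (auto simp: fixed_def)
  then have "sat (\<lambda>v. the (y v)) {}" using G(3) unfolding \<open>G = {}\<close> implied_def
    by (elim allE[of _ "\<lambda>v. the (y v)"]) simp
  then show False by (simp add: sat_def)
qed

lemma medium_wide:
  assumes "\<not> easy m y C" "easy s y C"
  shows "\<exists>X\<subseteq>fst ` C \<inter> {..<n}. m < card X"
proof -
  obtain G where G: "G \<subseteq> set F" "card G \<le> s" "implied y G C"
    "\<forall>D\<in>G. \<not> implied y (G - {D}) C" using easy_minimal[OF assms(2)] by metis
  have "m < card G" using G(1,3) assms(1) unfolding easy_def by (auto simp: not_le)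
  moreover obtain X where "X \<subseteq> fst ` C \<inter> {..<n}" "card G \<le> card X"
    using minimal_implied_wide[OF G(1-3)] G(4) by auto
  ultimately show ?thesis by (intro exI[of _ X]) simp
qed

text \<open>A clause made true by the restriction is implied by no axioms at all, hence easy for
  every \<open>m\<close>.\<close>

lemma not_easy_survives:
  assumes "\<not> easy m y C" "(v, c) \<in> C" "v \<in> fixed y"
  shows "y v \<noteq> Some c"
proof
  assume "y v = Some c"
  then have "implied y {} C" unfolding implied_def sat_def
    using assms(2,3) by (intro allI impI bexI[of _ "(v, c)"]) auto
  then show False using assms(1) unfolding easy_def by (auto dest: spec[of _ "{}"])
qed

section \<open>Few seeds make a given clause medium\<close>

text \<open>Markov's inequality for variable degrees: there are at most \<open>k * length F\<close>
  incidences.\<close>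

lemma card_high: "card ({..<n} - low) * b \<le> k * length F"
proof -
  have "card ({..<n} - low) * b = (\<Sum>v\<in>{..<n} - low. b)" by simp
  also have "\<dots> \<le> (\<Sum>v\<in>{..<n} - low. card {D \<in> set F. v \<in> fst ` D})"
    by (intro sum_mono) (auto simp: low_def)
  also have "\<dots> \<le> k * card (set F)"
    by (rule sum_occurrences_le) (use clauses in auto)
  also have "\<dots> \<le> k * length F" by (simp add: card_length)
  finally show ?thesis .
qed

lemma finite_low: "finite low" by (simp add: low_def)

lemma card_nbh:
  assumes "v \<in> low"
  shows "card (nbh v) \<le> b * k + 1" and "finite (nbh v)" and "nbh v \<subseteq> low"
proof -
  have sub: "nbh v \<subseteq> insert v (\<Union>D\<in>{D \<in> set F. v \<in> fst ` D}. fst ` D)" by (auto simp: nbh_def)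
  have "card (nbh v) \<le> card (insert v (\<Union>D\<in>{D \<in> set F. v \<in> fst ` D}. fst ` D))"
    using clauses by (intro card_mono[OF _ sub]) auto
  also have "\<dots> \<le> card (\<Union>D\<in>{D \<in> set F. v \<in> fst ` D}. fst ` D) + 1"
    by (rule card_insert_le_m1) simp_all
  also have "card (\<Union>D\<in>{D \<in> set F. v \<in> fst ` D}. fst ` D) \<le> (\<Sum>D\<in>{D \<in> set F. v \<in> fst ` D}. card (fst ` D))"
    by (intro card_UN_le) simp
  also have "\<dots> \<le> (\<Sum>D\<in>{D \<in> set F. v \<in> fst ` D}. k)" using clauses by (intro sum_mono) auto
  also have "\<dots> \<le> b * k" using assms by (auto simp: low_def)
  finally show "card (nbh v) \<le> b * k + 1" by simp
  show "nbh v \<subseteq> low" using assms by (auto simp: nbh_def)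
  then show "finite (nbh v)" using finite_low finite_subset by blast
qed

text \<open>Being a neighbour is symmetric on \<open>low\<close>, so every such \<open>u\<close>
  lies within two steps of \<open>v\<close>.\<close>

lemma card_meeting_nbh:
  assumes "v \<in> low" "W \<subseteq> low"
  shows "card {u \<in> W. nbh u \<inter> nbh v \<noteq> {}} \<le> (b * k + 1)\<^sup>2"
proof -
  have "{u \<in> W. nbh u \<inter> nbh v \<noteq> {}} \<subseteq> (\<Union>z\<in>nbh v. nbh z)"
  proof
    fix u assume "u \<in> {u \<in> W. nbh u \<inter> nbh v \<noteq> {}}"
    then obtain z where z: "u \<in> low" "z \<in> nbh u" "z \<in> nbh v" using assms by auto
    then have "u \<in> nbh z" by (auto simp: nbh_def)
    then show "u \<in> (\<Union>z\<in>nbh v. nbh z)" using z by blast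
  qed
  then have "card {u \<in> W. nbh u \<inter> nbh v \<noteq> {}} \<le> card (\<Union>z\<in>nbh v. nbh z)"
    using card_nbh(2,3)[OF assms(1)] card_nbh(2) by (intro card_mono) auto
  also have "\<dots> \<le> (\<Sum>z\<in>nbh v. card (nbh z))" by (rule card_UN_le[OF card_nbh(2)[OF assms(1)]])
  also have "\<dots> \<le> (\<Sum>z\<in>nbh v. b * k + 1)"
    using card_nbh(1) card_nbh(3)[OF assms(1)] by (intro sum_mono) auto
  also have "\<dots> \<le> (b * k + 1) * (b * k + 1)"
    using mult_right_mono[OF card_nbh(1)[OF assms(1)], of "b * k + 1"] by simp
  finally show ?thesis by (simp add: power2_eq_square)
qed

text \<open>If any seed makes \<open>C\<close> medium, then \<open>C\<close> has more than
  \<open>m\<close> variables, of which most are low and \<open>w\<close> have pairwise disjoint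
  neighbourhoods. Fixing one of these so as to satisfy \<open>C\<close> depends on its neighbourhood
  alone and would make \<open>C\<close> easy; a bad seed misses all these independent
  chances.\<close>

lemma card_medium:
  assumes w: "(b * k + 1)\<^sup>2 * w + card ({..<n} - low) \<le> m + 1"
  shows "real (card {y \<in> {..<n} \<rightarrow>\<^sub>E UNIV. \<not> easy m y C \<and> easy s y C})
    \<le> 3 ^ n * (1 - 1 / 3 ^ (b * k + 1)) ^ w"
proof (cases "\<exists>X\<subseteq>fst ` C \<inter> {..<n}. m < card X")
  case False
  then have "{y \<in> {..<n} \<rightarrow>\<^sub>E UNIV. \<not> easy m y C \<and> easy s y C} = {}"
    using medium_wide by blast
  moreover have "0 \<le> (1 - 1 / 3 ^ (b * k + 1) :: real)" by (simp add: divide_le_eq_1 del: power_Suc)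
  ultimately show ?thesis by (simp only: card.empty of_nat_0) (intro mult_nonneg_nonneg zero_le_power; simp)
next
  case True
  then obtain X where X: "X \<subseteq> fst ` C" "X \<subseteq> {..<n}" "m < card X" by blast
  define W where "W = X \<inter> low"
  have "X \<subseteq> W \<union> ({..<n} - low)" using X by (auto simp: W_def)
  then have "card X \<le> card (W \<union> ({..<n} - low))"
    using finite_low by (intro card_mono) (auto simp: W_def)
  then have "card X \<le> card W + card ({..<n} - low)" using card_Un_le le_trans by blast
  then have W: "(b * k + 1)\<^sup>2 * w \<le> card W" using X(3) w by linarith
  have W_low: "W \<subseteq> low" by (simp add: W_def)
  have "\<exists>W'\<subseteq>W. disjoint_family_on nbh W' \<and> card W \<le> (b * k + 1)\<^sup>2 * card W'"
  proof (rule disjoint_packing)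
    show "finite W" using W_low finite_low finite_subset by blast
    show "card {u \<in> W. nbh u \<inter> nbh v \<noteq> {}} \<le> (b * k + 1)\<^sup>2" if "v \<in> W" for v
      using card_meeting_nbh W_low that by blast
  qed (auto simp: nbh_def)
  then obtain W' where W': "W' \<subseteq> W" "disjoint_family_on nbh W'" "card W \<le> (b * k + 1)\<^sup>2 * card W'"
    by blast
  have "(b * k + 1)\<^sup>2 * w \<le> (b * k + 1)\<^sup>2 * card W'" using W W'(3) by linarith
  then have w_le: "w \<le> card W'" by simp
  have finW': "finite W'" using W' W_low finite_low by (meson finite_subset)
  define sg where "sg v = (SOME c. (v, c) \<in> C)" for v
  have sg: "(v, sg v) \<in> C" if "v \<in> W'" for v
  proof -
    have "v \<in> fst ` C" using that W'(1) X(1) unfolding W_def by blast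
    then have "\<exists>c. (v, c) \<in> C" by auto
    then show ?thesis unfolding sg_def by (rule someI_ex)
  qed
  \<comment> \<open>The pattern proposes \<open>v\<close> with the sign it has in \<open>C\<close>
    and nothing else nearby, so that \<open>v\<close> gets fixed and \<open>C\<close> becomes
    true.\<close>
  define p where "p v u = (if u = v then Some (sg v) else None)" for v u :: nat
  have CARD: "CARD(bool option) = 3" by simp
  have "\<exists>u\<in>nbh v. y u \<noteq> p v u" if y: "\<not> easy m y C" and v: "v \<in> W'" for y v
  proof (rule ccontr)
    assume "\<not> ?thesis"
    then have eq: "\<forall>u\<in>nbh v. y u = p v u" by blast
    then have "y v = Some (sg v)" by (simp add: nbh_def p_def)
    moreover have "v \<in> fixed y" using eq v W'(1) W_low calculation by (auto simp: fixed_def p_def)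
    ultimately show False using not_easy_survives[OF y sg[OF v]] by blast
  qed
  then have "{y \<in> {..<n} \<rightarrow>\<^sub>E UNIV. \<not> easy m y C \<and> easy s y C}
    \<subseteq> {y \<in> {..<n} \<rightarrow>\<^sub>E UNIV. \<forall>v\<in>W'. \<exists>u\<in>nbh v. y u \<noteq> p v u}" by auto
  then have "card {y \<in> {..<n} \<rightarrow>\<^sub>E UNIV. \<not> easy m y C \<and> easy s y C}
    \<le> card {y \<in> {..<n} \<rightarrow>\<^sub>E UNIV. \<forall>v\<in>W'. \<exists>u\<in>nbh v. y u \<noteq> p v u}"
    by (intro card_mono finite_subset[OF _ finite_PiE[of "{..<n}" "\<lambda>_. UNIV"]]) auto
  then have "real (card {y \<in> {..<n} \<rightarrow>\<^sub>E UNIV. \<not> easy m y C \<and> easy s y C})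
    \<le> real (card {y \<in> {..<n} \<rightarrow>\<^sub>E UNIV. \<forall>v\<in>W'. \<exists>u\<in>nbh v. y u \<noteq> p v u})" by simp
  also have "\<dots> \<le> real CARD(bool option) ^ card {..<n} * (1 - 1 / real CARD(bool option) ^ (b * k + 1)) ^ card W'"
  proof (rule card_avoid_patterns[OF finW' _ _ W'(2)])
    show "nbh v \<subseteq> {..<n} \<and> card (nbh v) \<le> b * k + 1" if "v \<in> W'" for v
      using card_nbh[of v] that W'(1) W_low by (auto simp: low_def)
  qed simp
  also have "\<dots> = 3 ^ n * (1 - 1 / 3 ^ (b * k + 1)) ^ card W'" unfolding CARD by simp
  also have "\<dots> \<le> 3 ^ n * (1 - 1 / 3 ^ (b * k + 1)) ^ w"
  proof (rule mult_left_mono[OF power_decreasing[OF w_le]])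
    show "(0::real) \<le> 1 - 1 / 3 ^ (b * k + 1)"
      using one_le_power[of "3::real" "b * k + 1"] by (simp only: diff_ge_0_iff_ge divide_le_eq_1) simp
  qed simp_all
  finally show ?thesis .
qed

text \<open>The exceptional clauses of the walk are those easy for \<open>s\<close> but not for
  \<open>s div 2\<close>. There are \<open>3 ^ n\<close> seeds, and \<open>q\<close> is the largest
  number with \<open>2 * t * q \<le> 3 ^ n\<close>; \<open>2 * t \<le> 3 ^ n\<close> makes it
  positive.\<close>

theorem reduction:
  assumes w: "(b * k + 1)\<^sup>2 * w + card ({..<n} - low) \<le> s div 2 + 1"
    and t: "0 < t" "2 * real t * (1 - 1 / 3 ^ (b * k + 1)) ^ w \<le> 1" "2 * t \<le> 3 ^ n"
  shows "refuter_to_rwphp_pls_reduction F t 2"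
proof (rule reduction_from_random_walk[where Y = "{..<n} \<rightarrow>\<^sub>E (UNIV :: bool option set)"
      and hi = "\<lambda>y C. \<not> easy s y C" and md = "\<lambda>y C. \<not> easy (s div 2) y C" and q = "3 ^ n div (2 * t)"])
  have card_Y: "card ({..<n} \<rightarrow>\<^sub>E (UNIV :: bool option set)) = 3 ^ n" by (simp add: card_PiE)
  show "2 * t * (3 ^ n div (2 * t)) \<le> card ({..<n} \<rightarrow>\<^sub>E (UNIV :: bool option set))"
    unfolding card_Y by simp
  show "0 < (3::nat) ^ n div (2 * t)" using t by (simp add: div_greater_zero_iff)
  have half: "s div 2 \<le> s" "2 * (s div 2) \<le> s" by simp_all
  show "\<not> easy (s div 2) y (C \<union> {(x, True)}) \<or> \<not> easy (s div 2) y (C \<union> {(x, False)})"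
    if "\<not> easy s y C" for y C x
    using that easy_resolution easy_mono half(2) by blast
  show "\<not> easy (s div 2) y C" if "\<not> easy s y C" for y C
    using that easy_mono half(1) by blast
  show "card {y \<in> {..<n} \<rightarrow>\<^sub>E UNIV. \<not> easy (s div 2) y C \<and> \<not> \<not> easy s y C} \<le> 3 ^ n div (2 * t)" (is "?c \<le> _") for C
  proof -
    have "real ?c \<le> 3 ^ n * (1 - 1 / 3 ^ (b * k + 1)) ^ w"
      using card_medium[OF w, of C] by simp
    then have "real ?c * (2 * real t) \<le> 3 ^ n * (1 - 1 / 3 ^ (b * k + 1)) ^ w * (2 * real t)"
      by (intro mult_right_mono) auto
    also have "\<dots> = 3 ^ n * (2 * real t * (1 - 1 / 3 ^ (b * k + 1)) ^ w)" by simp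
    also have "\<dots> \<le> 3 ^ n * 1" using t(2) by (intro mult_left_mono) auto
    finally have "real (?c * (2 * t)) \<le> real (3 ^ n)" by simp
    then have "?c * (2 * t) \<le> 3 ^ n" by (simp only: of_nat_le_iff)
    then show ?thesis using t(1) by (simp add: less_eq_div_iff_mult_less_eq)
  qed
qed (use t easy_weaken not_easy_empty easy_axiom in \<open>auto intro!: finite_PiE\<close>)

end

section \<open>Expansion of random formulas\<close>

text \<open>Induction along Pascal's rule: either the first clause satisfies \<open>Q\<close> and
  \<open>g - 1\<close> more come from the rest, or the rest already contains
  \<open>g\<close>.\<close>

lemma prob_many_in_iid_list:
  fixes p :: "'a pmf"
  shows "measure_pmf.prob (iid_list_pmf p m) {F. g \<le> card {C \<in> set F. Q C}}
    \<le> real (m choose g) * measure_pmf.prob p {C. Q C} ^ g"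
proof (induction m arbitrary: g)
  case 0
  then show ?case by (cases g) (auto simp: measure_pmf.prob_le_1)
next
  case (Suc m)
  define q where "q = measure_pmf.prob p {C. Q C}"
  show ?case
  proof (cases g)
    case 0
    then show ?thesis by (simp add: measure_pmf.prob_le_1)
  next
    case (Suc h)
    define E where "E g = {F :: 'a list. g \<le> card {C \<in> set F. Q C}}" for g
    define a where "a g = real (m choose g) * q ^ g" for g
    have a: "a g \<ge> 0" for g by (simp add: a_def q_def)
    have IH: "emeasure (iid_list_pmf p m) (E g) \<le> ennreal (a g)" for g
      using Suc.IH[of g] by (simp add: measure_pmf.emeasure_eq_measure E_def a_def q_def ennreal_leI)
    have step: "emeasure (map_pmf (\<lambda>F. C # F) (iid_list_pmf p m)) (E g)
      \<le> ennreal (a h) * indicator {C. Q C} C + ennreal (a g)" for C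
    proof -
      have "(\<lambda>F. C # F) -` E g \<subseteq> (if Q C then E h else {}) \<union> E g"
      proof
        fix F assume "F \<in> (\<lambda>F. C # F) -` E g"
        then have *: "g \<le> card {D \<in> set (C # F). Q D}" by (simp add: E_def)
        show "F \<in> (if Q C then E h else {}) \<union> E g"
        proof (cases "Q C")
          case True
          then have "{D \<in> set (C # F). Q D} = insert C {D \<in> set F. Q D}" by auto
          then have "g \<le> Suc (card {D \<in> set F. Q D})"
            using * card_insert_le_m1[of "Suc (card {D \<in> set F. Q D})" "{D \<in> set F. Q D}" C] by simp
          then show ?thesis using True Suc by (simp add: E_def)
        next
          case False
          then have "{D \<in> set (C # F). Q D} = {D \<in> set F. Q D}" by auto
          then show ?thesis using * by (simp add: E_def)
        qed
      qed
      then have "emeasure (iid_list_pmf p m) ((\<lambda>F. C # F) -` E g)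
        \<le> emeasure (iid_list_pmf p m) ((if Q C then E h else {}) \<union> E g)"
        by (intro emeasure_mono) auto
      also have "\<dots> \<le> emeasure (iid_list_pmf p m) (if Q C then E h else {}) + emeasure (iid_list_pmf p m) (E g)"
        by (intro emeasure_subadditive) auto
      also have "\<dots> \<le> ennreal (a h) * indicator {C. Q C} C + ennreal (a g)"
        using IH[of h] IH[of g] by (intro add_mono) auto
      finally show ?thesis by simp
    qed
    have "emeasure (iid_list_pmf p (Suc m)) (E g)
      = (\<integral>\<^sup>+C. emeasure (map_pmf (\<lambda>F. C # F) (iid_list_pmf p m)) (E g) \<partial>measure_pmf p)"
      by (simp only: iid_list_pmf.simps emeasure_bind_pmf)
    also have "\<dots> \<le> (\<integral>\<^sup>+C. (ennreal (a h) * indicator {C. Q C} C + ennreal (a g)) \<partial>measure_pmf p)"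
      by (intro nn_integral_mono step)
    also have "\<dots> = ennreal (a h) * emeasure p {C. Q C} + ennreal (a g)"
      by (subst nn_integral_add) (simp_all add: nn_integral_cmult_indicator measure_pmf.emeasure_space_1)
    also have "\<dots> = ennreal (a h * q + a g)"
      using a by (simp add: measure_pmf.emeasure_eq_measure q_def ennreal_mult ennreal_plus)
    finally have "ennreal (measure_pmf.prob (iid_list_pmf p (Suc m)) (E g)) \<le> ennreal (a h * q + a g)"
      by (simp only: measure_pmf.emeasure_eq_measure)
    moreover have "0 \<le> a h * q + a g" using a by (simp add: q_def)
    ultimately have "measure_pmf.prob (iid_list_pmf p (Suc m)) (E g) \<le> a h * q + a g"
      by (simp only: ennreal_le_iff)
    also have "\<dots> = real (Suc m choose g) * q ^ g"
      using Suc by (simp add: a_def algebra_simps)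
    finally show ?thesis by (simp add: E_def q_def)
  qed
qed

lemma set_pmf_iid_list: "F \<in> set_pmf (iid_list_pmf p m) \<Longrightarrow> set F \<subseteq> set_pmf p \<and> length F = m"
  by (induction m arbitrary: F) fastforce+

text \<open>Such a clause amounts to its variable set \<open>S\<close> together with the subset
  \<open>T\<close> of variables occurring positively.\<close>

lemma card_clauses_within:
  assumes "finite U"
  shows "card {C :: clause. card C = k \<and> fst ` C \<subseteq> U \<and> inj_on fst C} = (card U choose k) * 2 ^ k"
proof -
  let ?A = "SIGMA S:{S. S \<subseteq> U \<and> card S = k}. Pow S"
  let ?B = "{C :: clause. card C = k \<and> fst ` C \<subseteq> U \<and> inj_on fst C}"
  have "bij_betw (\<lambda>(S, T). (\<lambda>v. (v, v \<in> T)) ` S) ?A ?B"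
  proof (rule bij_betw_byWitness[where f' = "\<lambda>C. (fst ` C, {v. (v, True) \<in> C})"])
    show "\<forall>a\<in>?A. (\<lambda>C. (fst ` C, {v. (v, True) \<in> C})) (case a of (S, T) \<Rightarrow> (\<lambda>v. (v, v \<in> T)) ` S) = a"
      by (auto simp: image_image)
    show "\<forall>C\<in>?B. (case (fst ` C, {v. (v, True) \<in> C}) of (S, T) \<Rightarrow> (\<lambda>v. (v, v \<in> T)) ` S) = C"
    proof
      fix C assume C: "C \<in> ?B"
      have "(fst l, (fst l, True) \<in> C) = l" if "l \<in> C" for l
      proof -
        have "(fst l, True) \<in> C \<longleftrightarrow> snd l"
        proof
          assume "(fst l, True) \<in> C"
          then have "(fst l, True) = l" using C that inj_onD[of fst C "(fst l, True)" l] by simp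
          then show "snd l" by (metis snd_conv)
        qed (use that in \<open>metis (full_types) prod.collapse\<close>)
        then show ?thesis by (simp add: prod_eq_iff)
      qed
      then show "(case (fst ` C, {v. (v, True) \<in> C}) of (S, T) \<Rightarrow> (\<lambda>v. (v, v \<in> T)) ` S) = C"
        by (simp add: image_image)
    qed
    show "(\<lambda>(S, T). (\<lambda>v. (v, v \<in> T)) ` S) ` ?A \<subseteq> ?B"
      by (auto simp: image_image inj_on_def card_image)
    show "(\<lambda>C. (fst ` C, {v. (v, True) \<in> C})) ` ?B \<subseteq> ?A"
      by (auto simp: card_image intro: rev_image_eqI)
  qed
  then have "card ?B = card ?A" by (simp add: bij_betw_same_card)
  also have "\<dots> = (\<Sum>S | S \<subseteq> U \<and> card S = k. card (Pow S))"
    using assms by (intro card_SigmaI) (auto intro: finite_subset)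
  also have "\<dots> = (\<Sum>S | S \<subseteq> U \<and> card S = k. 2 ^ k)"
    using assms by (intro sum.cong) (auto simp: card_Pow finite_subset)
  also have "\<dots> = (card U choose k) * 2 ^ k" using assms by (simp add: n_subsets)
  finally show ?thesis .
qed

lemma ordinary_clauses_alt:
  "ordinary_clauses k n = {C. card C = k \<and> fst ` C \<subseteq> {..<n} \<and> inj_on fst C}"
  by (auto simp: ordinary_clauses_def)

lemma card_ordinary_clauses: "card (ordinary_clauses k n) = (n choose k) * 2 ^ k"
  unfolding ordinary_clauses_alt by (subst card_clauses_within) auto

text \<open>Compare factor by factor: \<open>(v - i) / (n - i) \<le> v / n\<close>.\<close>

lemma binomial_ratio_le:
  assumes "k \<le> n" "v \<le> n"
  shows "real (v choose k) \<le> (real v / real n) ^ k * real (n choose k)"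
proof (cases "k \<le> v")
  case True
  have "real (v choose k) = (\<Prod>i = 0..<k. real (v - i) / real (k - i))"
    using True by (rule binomial_altdef_of_nat)
  also have "\<dots> \<le> (\<Prod>i = 0..<k. (real v / real n) * (real (n - i) / real (k - i)))"
  proof (rule prod_mono)
    fix i assume i: "i \<in> {0..<k}"
    then have "0 < n" using assms by auto
    have "real i * real v \<le> real i * real n" using assms by (intro mult_left_mono) auto
    then have "real (v - i) * real n \<le> real v * real (n - i)"
      using i True assms by (simp add: of_nat_diff algebra_simps)
    then have "real (v - i) \<le> real v / real n * real (n - i)"
      using \<open>0 < n\<close> by (simp add: field_simps)
    then have "real (v - i) / real (k - i) \<le> real v / real n * real (n - i) / real (k - i)"
      by (intro divide_right_mono) auto
    then show "0 \<le> real (v - i) / real (k - i) \<and>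
      real (v - i) / real (k - i) \<le> real v / real n * (real (n - i) / real (k - i))" by simp
  qed
  also have "\<dots> = (real v / real n) ^ k * real (n choose k)"
    unfolding binomial_altdef_of_nat[OF assms(1)] prod.distrib by simp
  finally show ?thesis .
qed (simp add: binomial_eq_0)

lemma prob_clause_within:
  assumes "k \<le> n" "U \<subseteq> {..<n}"
  shows "measure_pmf.prob (pmf_of_set (ordinary_clauses k n)) {C. fst ` C \<subseteq> U}
    \<le> (real (card U) / real n) ^ k"
proof -
  have pos: "card (ordinary_clauses k n) > 0" using assms by (simp add: card_ordinary_clauses)
  then have fin: "finite (ordinary_clauses k n)" "ordinary_clauses k n \<noteq> {}"
    by (auto simp: card_gt_0_iff)
  have "ordinary_clauses k n \<inter> {C. fst ` C \<subseteq> U} = {C. card C = k \<and> fst ` C \<subseteq> U \<and> inj_on fst C}"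
    using assms(2) by (auto simp: ordinary_clauses_alt)
  moreover have "finite U" "card U \<le> n"
    using assms(2) finite_subset card_mono[OF _ assms(2)] by auto
  ultimately have "measure_pmf.prob (pmf_of_set (ordinary_clauses k n)) {C. fst ` C \<subseteq> U}
    = real ((card U choose k) * 2 ^ k) / real ((n choose k) * 2 ^ k)"
    by (simp only: measure_pmf_of_set[OF fin(2,1)] card_clauses_within card_ordinary_clauses)
  also have "\<dots> = real (card U choose k) / real (n choose k)" by simp
  also have "\<dots> \<le> (real (card U) / real n) ^ k"
    using binomial_ratio_le[OF assms(1) \<open>card U \<le> n\<close>] assms(1) by (simp add: divide_le_eq)
  finally show ?thesis .
qed

text \<open>A family of \<open>g\<close> clauses that fails to expand has fewer than
  \<open>r * g\<close> variables. Padding them to exactly \<open>r * g\<close> lets the union bound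
  run over sets of one size.\<close>

definition sparse_spots :: "nat \<Rightarrow> nat \<Rightarrow> nat \<Rightarrow> nat \<Rightarrow> cnf set" where
  "sparse_spots r s n k = {F. \<exists>g\<in>{1..s}. \<exists>U\<subseteq>{..<n}. card U = r * g \<and> g \<le> card {C \<in> set F. fst ` C \<subseteq> U}}"

lemma prob_sparse_spots:
  assumes "k \<le> n"
  shows "measure_pmf.prob (random_kcnf k n m) (sparse_spots r s n k)
    \<le> (\<Sum>g=1..s. real (n choose (r * g)) * (real (m choose g) * ((real (r * g) / real n) ^ k) ^ g))"
proof -
  let ?P = "measure_pmf.prob (random_kcnf k n m)"
  let ?U = "\<lambda>g. {U. U \<subseteq> {..<n} \<and> card U = r * g}"
  let ?E = "\<lambda>g U. {F :: cnf. g \<le> card {C \<in> set F. fst ` C \<subseteq> U}}"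
  have "sparse_spots r s n k = (\<Union>g\<in>{1..s}. \<Union>U\<in>?U g. ?E g U)" by (auto simp: sparse_spots_def)
  then have "?P (sparse_spots r s n k) \<le> (\<Sum>g=1..s. ?P (\<Union>U\<in>?U g. ?E g U))"
    by (simp only:) (intro measure_pmf.finite_measure_subadditive_finite, auto)
  also have "\<dots> \<le> (\<Sum>g=1..s. \<Sum>U\<in>?U g. ?P (?E g U))"
    by (intro sum_mono measure_pmf.finite_measure_subadditive_finite) auto
  also have "\<dots> \<le> (\<Sum>g=1..s. \<Sum>U\<in>?U g. real (m choose g) * ((real (r * g) / real n) ^ k) ^ g)"
  proof (intro sum_mono)
    fix g U assume U: "U \<in> ?U g"
    have "?P (?E g U) \<le> real (m choose g) *
        measure_pmf.prob (pmf_of_set (ordinary_clauses k n)) {C. fst ` C \<subseteq> U} ^ g"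
      unfolding random_kcnf_def by (rule prob_many_in_iid_list)
    also have "\<dots> \<le> real (m choose g) * ((real (r * g) / real n) ^ k) ^ g"
      using prob_clause_within[OF assms, of U] U by (intro mult_left_mono power_mono) auto
    finally show "?P (?E g U) \<le> real (m choose g) * ((real (r * g) / real n) ^ k) ^ g" .
  qed
  also have "\<dots> = (\<Sum>g=1..s. real (n choose (r * g)) * (real (m choose g) * ((real (r * g) / real n) ^ k) ^ g))"
    by (simp add: n_subsets)
  finally show ?thesis .
qed

section \<open>Estimating the union bound\<close>

lemma power_le_exp_fact: "real v ^ v \<le> exp 1 ^ v * fact v"
proof -
  have "(\<Sum>i\<in>{v}. real v ^ i /\<^sub>R fact i) \<le> (\<Sum>i. real v ^ i /\<^sub>R fact i)"
    by (rule sum_le_suminf[OF summable_exp_generic]) auto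
  then have "real v ^ v / fact v \<le> exp (real v)" by (simp add: exp_def divide_inverse mult.commute)
  also have "exp (real v) = exp 1 ^ v" by (simp add: exp_of_nat_mult[symmetric])
  finally show ?thesis by (simp add: divide_le_eq)
qed

lemma binomial_le_exp_power:
  assumes "0 < v"
  shows "real (n choose v) \<le> (exp 1 * real n / real v) ^ v"
proof -
  have "real (n choose v) * real v ^ v \<le> real (n choose v) * (exp 1 ^ v * fact v)"
    by (intro mult_left_mono power_le_exp_fact) auto
  also have "\<dots> = exp 1 ^ v * real ((n choose v) * fact v)" by simp
  also have "\<dots> \<le> exp 1 ^ v * real (n ^ v)"
    by (intro mult_left_mono of_nat_mono binomial_fact_pow) auto
  finally show ?thesis using assms by (simp add: power_divide power_mult_distrib le_divide_eq)
qed

text \<open>With \<open>x = g / n\<close> the term is at most \<open>(A * x ^ p) ^ g\<close>, as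
  \<open>k - r - 1 = p\<close>. Since \<open>8 * A * x \<le> 1\<close> and \<open>p \<ge> 4\<close>,
  the base is at most \<open>x ^ 3 / 8\<close>, and \<open>g ^ 3 \<le> 8 ^ g\<close> absorbs the
  numerator of \<open>x ^ 3\<close>.\<close>

lemma union_bound_term:
  fixes c \<alpha> :: real
  assumes g: "1 \<le> g" "real g \<le> \<alpha> * real n" and n: "0 < n" and r: "0 < r" and k: "k = r + 1 + p" "4 \<le> p"
    and m: "real m \<le> c * real n" and c: "0 < c"
    and \<alpha>: "\<alpha> \<le> 1" "8 * (exp 1 ^ (r + 1) * c * real r ^ (p + 1)) * \<alpha> \<le> 1"
  shows "real (n choose (r * g)) * (real (m choose g) * ((real (r * g) / real n) ^ k) ^ g)
    \<le> 1 / real n ^ 3"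
proof -
  define x where "x = real g / real n"
  have x: "0 < x" "x \<le> \<alpha>" using g n by (auto simp: x_def divide_le_eq)
  then have x1: "x \<le> 1" using \<alpha> by simp
  define A where "A = exp 1 ^ (r + 1) * c * real r ^ (p + 1)"
  have A: "0 < A" using c r by (simp add: A_def)
  have 1: "real (n choose (r * g)) \<le> ((exp 1 / (real r * x)) ^ r) ^ g"
    using binomial_le_exp_power[of "r * g" n] r g by (simp add: x_def power_mult)
  have 2: "real (m choose g) \<le> (exp 1 * c / x) ^ g"
  proof -
    have "real (m choose g) \<le> (exp 1 * real m / real g) ^ g"
      using binomial_le_exp_power[of g m] g by simp
    also have "\<dots> \<le> (exp 1 * (c * real n) / real g) ^ g"
      using m g by (intro power_mono divide_right_mono mult_left_mono) auto
    also have "exp 1 * (c * real n) / real g = exp 1 * c / x" by (simp add: x_def)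
    finally show ?thesis .
  qed
  have "real (n choose (r * g)) * (real (m choose g) * ((real (r * g) / real n) ^ k) ^ g)
    \<le> ((exp 1 / (real r * x)) ^ r) ^ g * ((exp 1 * c / x) ^ g * ((real r * x) ^ k) ^ g)"
  proof (intro mult_mono 1 2)
    show "((real (r * g) / real n) ^ k) ^ g \<le> ((real r * x) ^ k) ^ g" by (simp add: x_def)
  qed (use x r c in auto)
  also have "\<dots> = ((exp 1 / (real r * x)) ^ r * (exp 1 * c / x) * (real r * x) ^ k) ^ g"
    by (simp only: power_mult_distrib mult.assoc)
  also have "(exp 1 / (real r * x)) ^ r * (exp 1 * c / x) * (real r * x) ^ k = A * x ^ p"
  proof -
    have "(exp 1 / (real r * x)) ^ r * (real r * x) ^ r = exp 1 ^ r"
      using r x by (simp add: power_mult_distrib[symmetric])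
    moreover have "(exp 1 * c / x) * (real r * x) ^ (p + 1) = exp 1 * c * real r ^ (p + 1) * x ^ p"
      using x by (simp add: power_mult_distrib)
    moreover have "(real r * x) ^ k = (real r * x) ^ r * (real r * x) ^ (p + 1)"
      unfolding k(1) by (simp add: power_add)
    ultimately have "(exp 1 / (real r * x)) ^ r * (exp 1 * c / x) * (real r * x) ^ k
      = exp 1 ^ r * (exp 1 * c * real r ^ (p + 1) * x ^ p)"
      by (metis (no_types, opaque_lifting) mult.assoc mult.left_commute)
    then show ?thesis by (simp add: A_def)
  qed
  also have "(A * x ^ p) ^ g \<le> (x ^ 3 / 8) ^ g"
  proof (intro power_mono)
    have "A * x ^ p \<le> A * x ^ 4" using A x x1 k by (intro mult_left_mono power_decreasing) auto
    also have "\<dots> = A * x * x ^ 3" by (simp add: eval_nat_numeral)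
    also have "\<dots> \<le> (1 / 8) * x ^ 3"
    proof (rule mult_right_mono)
      have "A * x \<le> A * \<alpha>" using A x by (intro mult_left_mono) auto
      then show "A * x \<le> 1 / 8" using \<alpha>(2) unfolding A_def by linarith
    qed (use x in auto)
    finally show "A * x ^ p \<le> x ^ 3 / 8" by simp
  qed (use A x in auto)
  also have "(x ^ 3 / 8) ^ g = (x ^ 3) ^ g / 8 ^ g" by (simp add: power_divide)
  also have "\<dots> \<le> (x ^ 3) / 8 ^ g"
  proof (rule divide_right_mono)
    have "(x ^ 3) ^ g \<le> (x ^ 3) ^ 1" using x x1 g by (intro power_decreasing) (auto simp: power_le_one)
    then show "(x ^ 3) ^ g \<le> x ^ 3" by simp
  qed auto
  also have "\<dots> = (real g ^ 3 / 8 ^ g) / real n ^ 3" by (simp add: x_def power_divide)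
  also have "\<dots> \<le> 1 / real n ^ 3"
  proof (rule divide_right_mono)
    have "real g \<le> 2 ^ g" using less_exp[of g] by (metis less_imp_le of_nat_le_iff of_nat_numeral of_nat_power)
    then have "real g ^ 3 \<le> (2 ^ g) ^ 3" by (intro power_mono) auto
    also have "(2 ^ g) ^ 3 = ((2::real) ^ 3) ^ g" by (metis mult.commute power_mult)
    finally show "real g ^ 3 / 8 ^ g \<le> 1" by (simp add: divide_le_eq_1)
  qed auto
  finally show ?thesis .
qed

lemma expander_cnf_random:
  assumes F: "F \<in> set_pmf (random_kcnf k n m)" "F \<notin> sparse_spots r s n k"
    and k: "k \<le> n" "k + 2 \<le> 2 * r" and s: "1 \<le> s" "r * s \<le> n"
  shows "expander_cnf F n k r s" and "length F = m"
proof -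
  have "card (ordinary_clauses k n) > 0" using k by (simp add: card_ordinary_clauses)
  then have "finite (ordinary_clauses k n)" "ordinary_clauses k n \<noteq> {}"
    by (auto simp: card_gt_0_iff)
  then have "set F \<subseteq> ordinary_clauses k n" and len: "length F = m"
    using set_pmf_iid_list[OF F(1)[unfolded random_kcnf_def]] by (simp_all add: set_pmf_of_set)
  then have ord: "card D = k" "fst ` D \<subseteq> {..<n}" "inj_on fst D" if "D \<in> set F" for D
    using that by (auto simp: ordinary_clauses_alt)
  show "length F = m" by (rule len)
  show "expander_cnf F n k r s"
  proof
    fix D assume D: "D \<in> set F"
    have "finite (fst ` D)" using ord(2)[OF D] finite_subset by blast
    then have "finite D" using ord(3)[OF D] by (rule finite_imageD)
    then show "finite D \<and> card (fst ` D) \<le> k \<and> fst ` D \<subseteq> {..<n}"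
      using ord[OF D] card_image_le[of D fst] by simp
  next
    fix G assume G: "G \<subseteq> set F" "G \<noteq> {}" "card G \<le> s"
    show "r * card G \<le> card (fst ` \<Union>G)"
    proof (rule ccontr)
      assume small: "\<not> ?thesis"
      have finG: "finite G" using G finite_subset by blast
      have V: "fst ` \<Union>G \<subseteq> {..<n}" using G(1) ord(2) by blast
      have "r * card G \<le> r * s" using G(3) by (rule mult_le_mono2)
      then have "r * card G \<le> card {..<n}" using s(2) unfolding card_lessThan by (rule order_trans)
      \<comment> \<open>Room for the padding comes from \<open>r * s \<le> n\<close>.\<close>
      then obtain U where U: "fst ` \<Union>G \<subseteq> U" "U \<subseteq> {..<n}" "card U = r * card G"
        using exists_subset_between[of "fst ` \<Union>G" "r * card G" "{..<n}"] small V by auto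
      have "card G \<le> card {C \<in> set F. fst ` C \<subseteq> U}"
        using U(1) G(1) by (intro card_mono) auto
      moreover have "card G \<in> {1..s}" using G finG by (simp add: Suc_le_eq card_gt_0_iff)
      ultimately have "F \<in> sparse_spots r s n k" using U(2,3) unfolding sparse_spots_def by blast
      then show False using F(2) by simp
    qed
  qed (use k s in auto)
qed

section \<open>Borel-Cantelli and the choice of constants\<close>

lemma AE_eventually_PiM_pmf:
  fixes p :: "nat \<Rightarrow> 'a pmf"
  assumes "summable (\<lambda>n. measure_pmf.prob (p n) (A n))"
  shows "AE \<omega> in PiM UNIV (\<lambda>n. measure_pmf (p n)). \<forall>\<^sub>F n in sequentially. \<omega> n \<notin> A n"
proof -
  let ?M = "PiM UNIV (\<lambda>n. measure_pmf (p n))"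
  interpret product_prob_space "\<lambda>n. measure_pmf (p n)" UNIV
    by unfold_locales
  let ?E = "\<lambda>n. {\<omega> \<in> space ?M. \<omega> n \<in> A n}"
  have em: "emeasure ?M (?E n) = emeasure (p n) (A n)" for n
    by (rule emeasure_PiM_Collect_single) auto
  have "AE \<omega> in ?M. \<forall>\<^sub>F n in sequentially. \<omega> \<in> space ?M - ?E n"
  proof (rule borel_cantelli_AE1)
    show "?E n \<in> sets ?M" for n by (rule sets_Collect_single') auto
    show "emeasure ?M (?E n) < \<infinity>" for n
      by (simp add: em measure_pmf.emeasure_eq_measure)
    show "summable (\<lambda>n. measure ?M (?E n))"
      using assms by (simp add: Sigma_Algebra.measure_def em)
  qed
  then show ?thesis by (rule AE_mp) (auto intro!: AE_I2 elim: eventually_mono)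
qed

text \<open>Half of the decay \<open>\<beta> ^ w\<close> pays for \<open>t\<close>, the other half
  for the constant \<open>2 / \<beta>\<close>. The summand \<open>- 1\<close> comes from rounding
  \<open>w\<close> down and costs one factor \<beta>.\<close>

lemma theta_bound:
  fixes \<beta> \<gamma> :: real
  assumes \<beta>: "0 < \<beta>" "\<beta> < 1" and w: "2 * \<gamma> * real n - 1 \<le> real w"
    and t: "real t < (1 / (\<beta> powr \<gamma>)) ^ n" and small: "2 * (\<beta> powr \<gamma>) ^ n \<le> \<beta>"
  shows "2 * real t * \<beta> ^ w \<le> 1"
proof -
  let ?\<theta> = "\<beta> powr \<gamma>"
  have \<theta>: "0 < ?\<theta>" using \<beta> by simp
  have "\<beta> ^ w = \<beta> powr real w" using \<beta> by (simp add: powr_realpow)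
  also have "\<dots> \<le> \<beta> powr (2 * \<gamma> * real n - 1)" using \<beta> w by (intro powr_mono') auto
  also have "\<dots> = \<beta> powr (\<gamma> * real n) * \<beta> powr (\<gamma> * real n) / \<beta>"
    using \<beta> by (simp add: powr_diff powr_add[symmetric] mult.assoc)
  also have "\<beta> powr (\<gamma> * real n) = ?\<theta> ^ n"
    using \<beta> by (simp add: powr_powr[symmetric] powr_realpow)
  finally have 1: "\<beta> ^ w \<le> ?\<theta> ^ n * ?\<theta> ^ n / \<beta>" .
  have "2 * real t * \<beta> ^ w \<le> 2 * (1 / ?\<theta>) ^ n * (?\<theta> ^ n * ?\<theta> ^ n / \<beta>)"
    using t 1 \<beta> by (intro mult_mono) auto
  also have "\<dots> = 2 * ?\<theta> ^ n / \<beta>" using \<theta> by (simp add: power_divide)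
  also have "\<dots> \<le> 1" using small \<beta> by simp
  finally show ?thesis .
qed

theorem theorem5p10:
  shows "\<exists>K::nat. \<forall>k\<ge>K. \<forall>c::real. c \<ge> 0.7 * 2 ^ k \<longrightarrow>
     (\<exists>\<epsilon>::real. \<epsilon> > 0 \<and>
        (AE \<omega> in PiM UNIV (\<lambda>n. measure_pmf (random_kcnf k n (nat \<lfloor>c * real n\<rfloor>))).
           (\<forall>\<^sub>F n in sequentially. \<forall>t::nat. 0 < t \<and> real t < (1 + \<epsilon>) ^ n \<longrightarrow>
               refuter_to_rwphp_pls_reduction (\<omega> n) t 2)))"
proof (intro exI[of _ "14::nat"] allI impI)
  fix k :: nat and c :: real
  assume k: "14 \<le> k" and c: "0.7 * 2 ^ k \<le> c"
  have c0: "0 < c" using c by (rule less_le_trans[rotated]) simp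
  \<comment> \<open>This satisfies \<open>k + 2 \<le> 2 * r\<close>, and \<open>k \<ge> 14\<close>
    then leaves \<open>p \<ge> 4\<close> for the union bound.\<close>
  define r where "r = k div 2 + 2"
  define p where "p = k - r - 1"
  have r: "0 < r" "k = r + 1 + p" "4 \<le> p" "k + 2 \<le> 2 * r" using k by (auto simp: r_def p_def)
  define A where "A = exp 1 ^ (r + 1) * c * real r ^ (p + 1)"
  have A: "0 < A" using c0 r by (simp add: A_def)
  \<comment> \<open>The first bound serves \<open>union_bound_term\<close>, the second keeps
    \<open>r * s n \<le> n\<close>.\<close>
  define \<alpha> where "\<alpha> = min (1 / (8 * A)) (1 / real r)"
  have \<alpha>0: "0 < \<alpha>" using A r by (simp add: \<alpha>_def)
  have \<alpha>r: "real r * \<alpha> \<le> 1"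
    using r mult_left_mono[of \<alpha> "1 / real r" "real r"] by (simp add: \<alpha>_def)
  have "1 \<le> real r" using r(1) by simp
  then have "1 * \<alpha> \<le> real r * \<alpha>" using \<alpha>0 by (intro mult_right_mono) auto
  then have \<alpha>1: "\<alpha> \<le> 1" using \<alpha>r by simp
  have \<alpha>A: "8 * A * \<alpha> \<le> 1"
    using A mult_left_mono[of \<alpha> "1 / (8 * A)" "8 * A"] by (simp add: \<alpha>_def)
  \<comment> \<open>Large enough that at most \<open>\<alpha> * n / 8\<close> variables are not
    low.\<close>
  define b where "b = nat \<lceil>8 * real k * c / \<alpha>\<rceil>"
  have "0 < 8 * real k * c / \<alpha>" using k c0 \<alpha>0 by simp
  then have b: "8 * real k * c / \<alpha> \<le> real b" "0 < real b"
    unfolding b_def by linarith+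
  define d where "d = b * k + 1"
  define \<beta> :: real where "\<beta> = 1 - 1 / 3 ^ d"
  have "(1::real) < 3 ^ d" unfolding d_def by (intro one_less_power) auto
  then have \<beta>: "0 < \<beta>" "\<beta> < 1" by (simp_all add: \<beta>_def)
  define \<gamma> where "\<gamma> = \<alpha> / (8 * (real d)\<^sup>2)"
  have "0 < d" by (simp add: d_def)
  then have d0: "0 < real d" by simp
  have \<gamma>: "0 < \<gamma>" using \<alpha>0 d0 by (simp add: \<gamma>_def)
  define \<theta> where "\<theta> = \<beta> powr \<gamma>"
  have \<theta>: "0 < \<theta>" "\<theta> < 1"
    using \<beta> \<gamma> powr_less_mono'[of \<beta> 0 \<gamma>] by (auto simp: \<theta>_def)
  \<comment> \<open>The bound \<open>1 / \<theta> - 1\<close> is for \<open>theta_bound\<close>; the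
    bound 1 gives \<open>t < 2 ^ n\<close> and hence \<open>2 * t \<le> 3 ^ n\<close>.\<close>
  define \<epsilon> where "\<epsilon> = min 1 (1 / \<theta> - 1)"
  define m where "m n = nat \<lfloor>c * real n\<rfloor>" for n
  define s where "s n = nat \<lfloor>\<alpha> * real n\<rfloor>" for n
  have m: "real (m n) \<le> c * real n" for n using c0 by (simp add: m_def)
  have s_bounds: "real (s n) \<le> \<alpha> * real n" "\<alpha> * real n < real (s n) + 1" for n
    using \<alpha>0 by (simp_all add: s_def)
  have rs: "r * s n \<le> n" for n
  proof -
    have "real r * real (s n) \<le> real r * (\<alpha> * real n)" using s_bounds(1) by (intro mult_left_mono) auto
    also have "\<dots> \<le> 1 * real n" unfolding mult.assoc[symmetric] using \<alpha>r by (intro mult_right_mono) auto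
    finally have "real (r * s n) \<le> real n" by simp
    then show ?thesis by (simp only: of_nat_le_iff)
  qed
  \<comment> \<open>At most \<open>n\<close> values of \<open>g\<close> contribute at most
    \<open>1 / n ^ 3\<close> each.\<close>
  have "summable (\<lambda>n. measure_pmf.prob (random_kcnf k n (m n)) (sparse_spots r (s n) n k))"
  proof (rule summable_comparison_test_ev)
    show "summable (\<lambda>n. 1 / real n ^ 2)" using inverse_power_summable[of 2, where 'a = real]
      by (simp add: field_simps)
    show "\<forall>\<^sub>F n in sequentially.
      norm (measure_pmf.prob (random_kcnf k n (m n)) (sparse_spots r (s n) n k)) \<le> 1 / real n ^ 2"
      using eventually_ge_at_top[of k]
    proof eventually_elim
      case (elim n)
      then have n: "0 < n" using k by simp
      have "measure_pmf.prob (random_kcnf k n (m n)) (sparse_spots r (s n) n k)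
        \<le> (\<Sum>g=1..s n. real (n choose (r * g)) * (real (m n choose g) * ((real (r * g) / real n) ^ k) ^ g))"
        by (rule prob_sparse_spots[OF elim])
      also have "\<dots> \<le> (\<Sum>g=1..s n. 1 / real n ^ 3)"
      proof (rule sum_mono)
        fix g assume g: "g \<in> {1..s n}"
        then have "real g \<le> \<alpha> * real n" using s_bounds(1)[of n] by (auto intro: order_trans[of _ "real (s n)"])
        then show "real (n choose (r * g)) * (real (m n choose g) * ((real (r * g) / real n) ^ k) ^ g)
          \<le> 1 / real n ^ 3"
          using g n r m c0 \<alpha>1 \<alpha>A by (intro union_bound_term[where \<alpha> = \<alpha> and c = c and p = p]) (auto simp: A_def)
      qed
      also have "\<dots> = real (s n) / real n ^ 3" by simp
      also have "\<dots> \<le> real n / real n ^ 3"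
      proof (rule divide_right_mono)
        have "\<alpha> * real n \<le> 1 * real n" using \<alpha>1 by (intro mult_right_mono) auto
        then show "real (s n) \<le> real n" using s_bounds(1)[of n] by simp
      qed simp
      also have "\<dots> = 1 / real n ^ 2" using n by (simp add: eval_nat_numeral)
      finally show ?case by simp
    qed
  qed
  then have AE1: "AE \<omega> in PiM UNIV (\<lambda>n. measure_pmf (random_kcnf k n (m n))).
    \<forall>\<^sub>F n in sequentially. \<omega> n \<notin> sparse_spots r (s n) n k"
    by (rule AE_eventually_PiM_pmf)
  \<comment> \<open>Membership in the supports provides well-formed clauses and the length
    \<open>m n\<close>.\<close>
  have "AE \<omega> in PiM UNIV (\<lambda>n. measure_pmf (random_kcnf k n (m n))). \<omega> n \<in> set_pmf (random_kcnf k n (m n))" for n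
    by (rule AE_PiM_component) (auto simp: AE_measure_pmf_iff measure_pmf.prob_space_axioms)
  then have AE2: "AE \<omega> in PiM UNIV (\<lambda>n. measure_pmf (random_kcnf k n (m n))).
    \<forall>n. \<omega> n \<in> set_pmf (random_kcnf k n (m n))"
    by (simp add: AE_all_countable)
  have reduction: "refuter_to_rwphp_pls_reduction F t 2"
    if F: "F \<in> set_pmf (random_kcnf k n (m n))" "F \<notin> sparse_spots r (s n) n k"
      and n: "k \<le> n" "1 \<le> \<alpha> * real n" "2 * \<theta> ^ n \<le> \<beta>" and t: "0 < t" "real t < (1 + \<epsilon>) ^ n"
    for F n t
  proof -
    have s1: "1 \<le> s n" using n(2) by (simp add: s_def le_nat_iff)
    interpret expander_cnf F n k r "s n" b
      by (rule expander_cnf_random(1)[OF F n(1) r(4) s1 rs])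
    have len: "length F = m n" by (rule expander_cnf_random(2)[OF F n(1) r(4) s1 rs])
    define w where "w = nat \<lfloor>2 * \<gamma> * real n\<rfloor>"
    have "0 \<le> 2 * \<gamma> * real n" using \<gamma> by simp
    then have w: "real w \<le> 2 * \<gamma> * real n" "2 * \<gamma> * real n - 1 \<le> real w"
      unfolding w_def by linarith+
    show ?thesis
    proof (rule reduction[of w])
      have "(real d)\<^sup>2 * real w \<le> (real d)\<^sup>2 * (2 * \<gamma> * real n)"
        using w(1) by (intro mult_left_mono) auto
      also have "\<dots> = \<alpha> * real n / 4" using d0 by (simp add: \<gamma>_def)
      finally have 1: "(real d)\<^sup>2 * real w \<le> \<alpha> * real n / 4" .
      have "real (card ({..<n} - low)) * real b \<le> real k * real (m n)"
        using card_high unfolding len by (metis of_nat_le_iff of_nat_mult)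
      also have "\<dots> \<le> real k * (c * real n)" using m by (intro mult_left_mono) auto
      also have "\<dots> = (8 * real k * c / \<alpha>) * (\<alpha> * real n / 8)" using \<alpha>0 by simp
      also have "\<dots> \<le> real b * (\<alpha> * real n / 8)" using b \<alpha>0 by (intro mult_right_mono) auto
      finally have 2: "real (card ({..<n} - low)) \<le> \<alpha> * real n / 8"
        using b(2) by (simp add: mult.commute)
      \<comment> \<open>The two estimates add up to \<open>3 * \<alpha> * n / 8\<close>, below
        \<open>(s n + 1) / 2\<close>.\<close>
      have "s n + 1 \<le> 2 * (s n div 2 + 1)" by presburger
      then have "real (s n + 1) \<le> real (2 * (s n div 2 + 1))" by (simp only: of_nat_le_iff)
      then have "real (d\<^sup>2 * w + card ({..<n} - low)) \<le> real (s n div 2 + 1)"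
        using 1 2 s_bounds(2)[of n] n(2) by simp
      then show "(b * k + 1)\<^sup>2 * w + card ({..<n} - low) \<le> s n div 2 + 1"
        unfolding d_def by (simp only: of_nat_le_iff)
      have "(1 + \<epsilon>) ^ n \<le> (1 / \<theta>) ^ n"
        using \<theta> by (intro power_mono) (auto simp: \<epsilon>_def)
      then have "2 * real t * \<beta> ^ w \<le> 1"
        using theta_bound[OF \<beta> w(2), of t] t n(3) unfolding \<theta>_def by simp
      then show "2 * real t * (1 - 1 / 3 ^ (b * k + 1)) ^ w \<le> 1" by (simp only: \<beta>_def d_def)
      have "(1 + \<epsilon>) ^ n \<le> 2 ^ n" using \<theta> by (intro power_mono) (auto simp: \<epsilon>_def)
      then have "real t < 2 ^ n" using t(2) by linarith
      moreover have "(2::real) * 2 ^ n \<le> 3 ^ n"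
      proof -
        have "2 \<le> n" using n(1) k by simp
        then show ?thesis
        proof (induction n rule: dec_induct)
          case (step j)
          then have "2 * (2 * 2 ^ j) \<le> 3 * (3::real) ^ j" by (intro mult_mono) auto
          then show ?case by simp
        qed simp
      qed
      ultimately have "2 * real t \<le> 3 ^ n" by linarith
      then have "real (2 * t) \<le> real (3 ^ n)" by (simp only: of_nat_mult of_nat_power of_nat_numeral)
      then show "2 * t \<le> 3 ^ n" by (simp only: of_nat_le_iff)
    qed (rule t(1))
  qed
  have "(\<lambda>n. 2 * \<theta> ^ n) \<longlonglongrightarrow> 2 * 0"
    using \<theta> by (intro tendsto_intros LIMSEQ_power_zero) auto
  then have ev1: "\<forall>\<^sub>F n in sequentially. 2 * \<theta> ^ n < \<beta>"
    using \<beta> by (intro order_tendstoD) auto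
  have ev2: "\<forall>\<^sub>F n in sequentially. 1 \<le> \<alpha> * real n"
    using eventually_ge_at_top[of "nat \<lceil>1 / \<alpha>\<rceil>"]
  proof eventually_elim
    case (elim n)
    then have "1 / \<alpha> \<le> real n" by linarith
    then show ?case using \<alpha>0 by (simp add: field_simps)
  qed
  have "AE \<omega> in PiM UNIV (\<lambda>n. measure_pmf (random_kcnf k n (m n))).
    \<forall>\<^sub>F n in sequentially. \<forall>t::nat. 0 < t \<and> real t < (1 + \<epsilon>) ^ n \<longrightarrow>
      refuter_to_rwphp_pls_reduction (\<omega> n) t 2"
    using AE1 AE2
  proof eventually_elim
    case E: (elim \<omega>)
    show ?case
      using E(1) ev1 ev2 eventually_ge_at_top[of k]
    proof eventually_elim
      case (elim n)
      then show ?case using reduction[of "\<omega> n" n] E(2) by auto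
    qed
  qed
  moreover have "0 < \<epsilon>" using \<theta> by (simp add: \<epsilon>_def)
  ultimately show "\<exists>\<epsilon>::real. \<epsilon> > 0 \<and>
        (AE \<omega> in PiM UNIV (\<lambda>n. measure_pmf (random_kcnf k n (nat \<lfloor>c * real n\<rfloor>))).
           (\<forall>\<^sub>F n in sequentially. \<forall>t::nat. 0 < t \<and> real t < (1 + \<epsilon>) ^ n \<longrightarrow>
               refuter_to_rwphp_pls_reduction (\<omega> n) t 2))"
    unfolding m_def by blast
qed

end
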